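(* Let $n\ge 3$ be an integer and let $G$ be a $2K_3$-free graph on $n$ vertices. Then $$\mu_3(G)\le\begin{cases}\mu_3(K_n), & 3\le n\le 5,\\ \mu_3(K_5\cup K_1), & n=6,\\ \mu_3(K_3\vee (n-3)K_1), & 7\le n\le 13,\\ \mu_3(K_1\vee T_2(n-1)), & n\ge 14.\end{cases}$$ Moreover: (i) for $3\le n\le 5$, equality holds if and only if $G\cong K_n$; (ii) for $n=6$, equality holds if and only if $G\cong K_5\cup K_1$ or $G\cong G_0$, where $G_0$ is obtained from $K_5\cup K_1$ by adding an edge between a vertex of $K_5$ and the isolated vertex; (iii) for $7\le n\le 13$, equality holds if and only if $G\cong K_3\vee (n-3)K_1$; (iv) for $n\ge 14$, equality holds if and only if $G\cong K_1\vee T_2(n-1)$.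
   Context: All graphs are finite, undirected and simple. $mF$ is the disjoint union of $m$ copies of $F$, and $\cup$ denotes disjoint union. A graph is $F$-free if it does not contain $F$ as a (not necessarily induced) subgraph. $G\vee H$ is the join: the disjoint union of $G$ and $H$ together with all edges between $V(G)$ and $V(H)$. $T_2(m)$ is the complete bipartite graph on $m$ vertices whose part sizes differ by at most one. A $3$-clique of $G$ is a $3$-element subset of $V(G)$ inducing a complete graph. For $G$ with vertex set $\{1,\dots,n\}$, the $3$-clique tensor $\mathcal{A}_3(G)=(a_{ijk})$ is the order-$3$ dimension-$n$ tensor with $a_{ijk}=\frac{1}{2}$ if $\{i,j,k\}$ is a $3$-clique of $G$ and $0$ otherwise. A complex number $\lambda$ is an eigenvalue of an order-$3$ dimension-$n$ tensor $(a_{ijk})$ if there is a nonzero $x\in\mathbb{C}^n$ with $\sum_{j,k=1}^n a_{ijk}x_jx_k=\lambda x_i^{2}$ for all $i$; the spectral radius is the maximum modulus of the eigenvalues. The $3$-clique spectral radius $\mu_3(G)$ is the spectral radius of $\mathcal{A}_3(G)$. *)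

theory Defs
  imports Complex_Main
begin

section \<open>Finite simple graphs\<close>

record 'a sgraph =
  vertex_set :: "'a set"
  edge_set :: "'a set set"

definition simple_graph :: "'a sgraph \<Rightarrow> bool" where
  "simple_graph G \<longleftrightarrow> finite (vertex_set G) \<and>
     (\<forall>e \<in> edge_set G. e \<subseteq> vertex_set G \<and> card e = 2)"

definition graph_iso :: "'a sgraph \<Rightarrow> 'b sgraph \<Rightarrow> bool" where
  "graph_iso G H \<longleftrightarrow> (\<exists>f. bij_betw f (vertex_set G) (vertex_set H) \<and>
     (\<forall>u \<in> vertex_set G. \<forall>v \<in> vertex_set G. {u, v} \<in> edge_set G \<longleftrightarrow> {f u, f v} \<in> edge_set H))"

text \<open>\<open>contains_copy G F\<close>: some not necessarily induced subgraph of \<open>G\<close> is isomorphic to \<open>F\<close>.\<close>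

definition contains_copy :: "'a sgraph \<Rightarrow> 'b sgraph \<Rightarrow> bool" where
  "contains_copy G F \<longleftrightarrow> (\<exists>f. inj_on f (vertex_set F) \<and> f ` vertex_set F \<subseteq> vertex_set G \<and>
     (\<forall>e \<in> edge_set F. f ` e \<in> edge_set G))"

definition graph_free :: "'b sgraph \<Rightarrow> 'a sgraph \<Rightarrow> bool" where
  "graph_free F G \<longleftrightarrow> \<not> contains_copy G F"

definition complete_graph :: "nat \<Rightarrow> nat sgraph" where
  "complete_graph n = \<lparr>vertex_set = {..<n}, edge_set = {e. e \<subseteq> {..<n} \<and> card e = 2}\<rparr>"

definition disjoint_union :: "'a sgraph \<Rightarrow> 'b sgraph \<Rightarrow> ('a + 'b) sgraph" where
  "disjoint_union G H =
     \<lparr>vertex_set = vertex_set G <+> vertex_set H,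
      edge_set = (`) Inl ` edge_set G \<union> (`) Inr ` edge_set H\<rparr>"

definition graph_join :: "'a sgraph \<Rightarrow> 'b sgraph \<Rightarrow> ('a + 'b) sgraph" where
  "graph_join G H =
     \<lparr>vertex_set = vertex_set (disjoint_union G H),
      edge_set = edge_set (disjoint_union G H) \<union>
        {{Inl u, Inr v} | u v. u \<in> vertex_set G \<and> v \<in> vertex_set H}\<rparr>"

definition copies :: "nat \<Rightarrow> 'a sgraph \<Rightarrow> (nat \<times> 'a) sgraph" where
  "copies m F =
     \<lparr>vertex_set = {..<m} \<times> vertex_set F,
      edge_set = {Pair i ` e | i e. i < m \<and> e \<in> edge_set F}\<rparr>"

definition add_edge :: "'a \<Rightarrow> 'a \<Rightarrow> 'a sgraph \<Rightarrow> 'a sgraph" where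
  "add_edge u v G = G\<lparr>edge_set := insert {u, v} (edge_set G)\<rparr>"

definition complete_bipartite :: "nat \<Rightarrow> nat \<Rightarrow> (nat + nat) sgraph" where
  "complete_bipartite a b =
     \<lparr>vertex_set = {..<a} <+> {..<b}, edge_set = {{Inl i, Inr j} | i j. i < a \<and> j < b}\<rparr>"

definition turan2 :: "nat \<Rightarrow> (nat + nat) sgraph" where
  "turan2 m = complete_bipartite (m div 2) (m - m div 2)"

text \<open>The graph \<open>G\<^sub>0\<close>: \<open>K\<^sub>5 \<union> K\<^sub>1\<close> plus an edge joining a vertex of \<open>K\<^sub>5\<close>
  (by symmetry, the vertex 0) to the isolated vertex.\<close>

definition pendant_K5 :: "(nat + nat) sgraph" where
  "pendant_K5 =
     add_edge (Inl 0) (Inr 0) (disjoint_union (complete_graph 5) (complete_graph 1))"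

section \<open>The 3-clique tensor and its spectral radius\<close>

text \<open>Tensors are indexed by a finite set \<open>V\<close> (the vertex set) in place of \<open>{1,\<dots>,n}\<close>;
  only the values of vectors and tensors on \<open>V\<close> matter.\<close>

definition is_3clique :: "'a sgraph \<Rightarrow> 'a set \<Rightarrow> bool" where
  "is_3clique G S \<longleftrightarrow> S \<subseteq> vertex_set G \<and> card S = 3 \<and>
     (\<forall>u \<in> S. \<forall>v \<in> S. u \<noteq> v \<longrightarrow> {u, v} \<in> edge_set G)"

definition clique_tensor3 :: "'a sgraph \<Rightarrow> 'a \<Rightarrow> 'a \<Rightarrow> 'a \<Rightarrow> complex" where
  "clique_tensor3 G i j k = (if is_3clique G {i, j, k} then 1 / 2 else 0)"

definition tensor3_eigenvalue ::
    "'a set \<Rightarrow> ('a \<Rightarrow> 'a \<Rightarrow> 'a \<Rightarrow> complex) \<Rightarrow> complex \<Rightarrow> bool" where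
  "tensor3_eigenvalue V a l \<longleftrightarrow> (\<exists>x :: 'a \<Rightarrow> complex. (\<exists>i \<in> V. x i \<noteq> 0) \<and>
     (\<forall>i \<in> V. (\<Sum>j \<in> V. \<Sum>k \<in> V. a i j k * x j * x k) = l * (x i)\<^sup>2))"

text \<open>\<open>Max\<close> would need finiteness of the set of eigenvalues; \<open>Greatest\<close> only needs that the
  maximum is attained.\<close>

definition tensor3_spectral_radius :: "'a set \<Rightarrow> ('a \<Rightarrow> 'a \<Rightarrow> 'a \<Rightarrow> complex) \<Rightarrow> real" where
  "tensor3_spectral_radius V a = (GREATEST r. \<exists>l. tensor3_eigenvalue V a l \<and> r = cmod l)"

definition mu3 :: "'a sgraph \<Rightarrow> real" where
  "mu3 G = tensor3_spectral_radius (vertex_set G) (clique_tensor3 G)"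

end

theory Submission
  imports Defs "HOL-Analysis.Function_Topology"
begin

text \<open>
  The proof compares spectral radii through a variational principle. For nonnegative \<open>x\<close> put
  \<open>P x = 3 * triangle_sum G x\<close>, three times the sum over all triangles of the product of the entries of \<open>x\<close>. As for
  nonnegative matrices, \<open>mu3 G\<close> is the maximum of \<open>P x\<close> subject to \<open>(\<Sum>v. x v ^ 3) = 1\<close>
  (\<open>mu3_attained\<close>), so it depends only on the family of triangles, and grows with it.

  A graph without two disjoint triangles has a triangle family whose members pairwise meet, and such
  families are very restricted when they consist of all triangles of a graph (\<open>triangle_structure\<close>).
  Either all triangles share a vertex \<open>v\<close>; or there is a core of three vertices such that each triangle contains
  two of them, so that the triangles are among those of \<open>K\<^sub>3 \<or> (n - 3) K\<^sub>1\<close>; or all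
  triangles lie in a \<open>K\<^sub>5\<close>; or there are at most \<open>n\<close> triangles. Each case has its own bound.

  \<^item> If all triangles share a vertex \<open>v\<close>, they are the edges of a triangle-free graph, the link of \<open>v\<close>. The
    power mean inequality and the weighted form of Mantel's theorem give \<open>mu3 G ^ 3 \<le> t\<^sup>2\<close> for \<open>t\<close> triangles
    (\<open>mu3_cubed_le_star\<close>), and Mantel's theorem bounds \<open>t\<close> by \<open>(n - 1)\<^sup>2 div 4\<close>. Both can be equalities only for
    \<open>K\<^sub>1 \<or> T\<^sub>2(n - 1)\<close> (\<open>coloured_if_extremal\<close>).
  \<^item> In the core case the positive eigenvector of \<open>K\<^sub>3 \<or> (n - 3) K\<^sub>1\<close> certifies that \<open>mu3 G\<close> is at most
    the root \<open>l\<close> of \<open>l * (l - 1)\<^sup>2 = 12 * (n - 3)\<^sup>2\<close>, with equality only if no triangle is missing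
    (\<open>mu3_le_core\<close>).
  \<^item> In the \<open>K\<^sub>5\<close> case the constant vector certifies \<open>mu3 G \<le> 6\<close>.
  \<^item> With at most \<open>n\<close> triangles the crude bound \<open>mu3 G ^ 3 \<le> 9 / 2 * n\<^sup>2\<close> suffices.

  It remains to compare numbers. The constant 6 wins for \<open>n = 6\<close>, the cubic root \<open>l\<close>, of
  order \<open>n\<close> to the power \<open>2 / 3\<close>, for \<open>7 \<le> n \<le> 13\<close>, and the star bound, of order \<open>n\<close> to the power
  \<open>4 / 3\<close>, from \<open>n = 14\<close> on. For \<open>n \<le> 5\<close> the constant vector already certifies that
  \<open>K\<^sub>n\<close> is optimal among all graphs.
\<close>

section \<open>The spectral radius as a maximum of the triangle form\<close>

definition triangles :: "'a sgraph \<Rightarrow> 'a set set" where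
  "triangles G = {T. is_3clique G T}"

text \<open>\<open>3 * triangle_sum G x\<close> is the cubic form of the clique tensor: contracting the tensor with \<open>x\<close>
  three times counts each triangle six times with weight \<open>1 / 2\<close>.\<close>

definition triangle_sum :: "'a sgraph \<Rightarrow> ('a \<Rightarrow> 'b::comm_semiring_1) \<Rightarrow> 'b" where
  "triangle_sum G x = (\<Sum>T\<in>triangles G. \<Prod>v\<in>T. x v)"

text \<open>A third of the partial derivative of \<open>3 * triangle_sum G\<close> in direction \<open>i\<close>, that is, the left-hand side of
  the eigenvalue equation at \<open>i\<close>. The scalars stay generic because the eigenvalue equation is
  complex while all estimates are real.\<close>

definition link_sum :: "'a sgraph \<Rightarrow> 'a \<Rightarrow> ('a \<Rightarrow> 'b::comm_semiring_1) \<Rightarrow> 'b" where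
  "link_sum G i x = (\<Sum>T | T \<in> triangles G \<and> i \<in> T. \<Prod>v\<in>T - {i}. x v)"

lemma triangle_subset: "T \<in> triangles G \<Longrightarrow> T \<subseteq> vertex_set G"
  by (auto simp: triangles_def is_3clique_def)

lemma triangle_card: "T \<in> triangles G \<Longrightarrow> card T = 3"
  by (auto simp: triangles_def is_3clique_def)

lemma triangle_finite: "T \<in> triangles G \<Longrightarrow> finite T"
  using triangle_card by (metis card.infinite zero_neq_numeral)

lemma finite_triangles: "finite (vertex_set G) \<Longrightarrow> finite (triangles G)"
  by (rule finite_subset[of _ "Pow (vertex_set G)"]) (auto dest: triangle_subset)

lemma card_3_iff_member:
  assumes "card T = 3" "i \<in> T"
  obtains p q where "T = {i, p, q}" "i \<noteq> p" "i \<noteq> q" "p \<noteq> q"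
proof -
  have "card (T - {i}) = 2" using assms by (simp add: card_Diff_singleton)
  then obtain p q where "T - {i} = {p, q}" "p \<noteq> q" by (auto simp: card_2_iff)
  then show ?thesis using assms(2) by (intro that[of p q]) auto
qed

text \<open>Each triangle through \<open>i\<close> is hit by exactly two ordered pairs \<open>(j, k)\<close>, which cancels the
  weight \<open>1 / 2\<close>. The real instance is used later to read link sums as sums over ordered pairs.\<close>

lemma tensor_row_eq_link_sum:
  fixes x :: "'a \<Rightarrow> 'b::field_char_0"
  assumes "finite (vertex_set G)"
  shows "(\<Sum>j\<in>vertex_set G. \<Sum>k\<in>vertex_set G.
            (if is_3clique G {i, j, k} then 1 / 2 else 0) * x j * x k) = link_sum G i x"
proof -
  let ?V = "vertex_set G"
  let ?D = "{(j, k). is_3clique G {i, j, k}}"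
  let ?h = "\<lambda>(j, k). {i, j, k}"
  let ?g = "\<lambda>(j, k). 1 / 2 * x j * x k"
  have D: "?D \<subseteq> ?V \<times> ?V" by (auto simp: is_3clique_def)
  have "(\<Sum>j\<in>?V. \<Sum>k\<in>?V. (if is_3clique G {i, j, k} then 1 / 2 else 0) * x j * x k)
      = (\<Sum>p\<in>?V \<times> ?V. if p \<in> ?D then ?g p else 0)"
    by (simp add: sum.cartesian_product) (rule sum.cong, auto)
  also have "\<dots> = (\<Sum>p\<in>?D. ?g p)"
    using D assms by (intro sum.mono_neutral_cong_right) (auto split: if_splits)
  also have "\<dots> = (\<Sum>T | T \<in> triangles G \<and> i \<in> T. \<Sum>p | p \<in> ?D \<and> ?h p = T. ?g p)"
    using finite_subset[OF D] finite_triangles[OF assms] assms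
    by (intro sum.group[symmetric]) (auto simp: triangles_def)
  also have "\<dots> = link_sum G i x"
    unfolding link_sum_def
  proof (rule sum.cong[OF refl])
    fix T assume T: "T \<in> {T. T \<in> triangles G \<and> i \<in> T}"
    then obtain p q where pq: "T = {i, p, q}" "i \<noteq> p" "i \<noteq> q" "p \<noteq> q"
      using card_3_iff_member[OF triangle_card, of T G i] by auto
    \<comment> \<open>Here \<open>i\<close> itself cannot be \<open>j\<close> or \<open>k\<close>, since the triple would have fewer than three elements.\<close>
    have "{r. r \<in> ?D \<and> ?h r = T} = {(p, q), (q, p)}"
    proof -
      have "{i, j, k} = {i, p, q} \<longleftrightarrow> {j, k} = {p, q} \<or> i \<in> {j, k} \<and> {j, k} \<subseteq> {i, p, q} \<and> {p, q} \<subseteq> {j, k}"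
        for j k using pq(2-4) by auto
      moreover have "\<not> {p, q} \<subseteq> {j, k} \<or> i \<notin> {j, k}" for j k
        using pq(2-4) by auto
      ultimately have "{i, j, k} = {i, p, q} \<longleftrightarrow> (j = p \<and> k = q) \<or> (j = q \<and> k = p)" for j k
        by (auto simp: doubleton_eq_iff)
      moreover have "is_3clique G {i, p, q}" using T pq(1) by (simp add: triangles_def)
      ultimately show ?thesis unfolding pq(1) by (auto simp: insert_commute)
    qed
    moreover have "T - {i} = {p, q}" using pq by auto
    ultimately show "(\<Sum>r | r \<in> ?D \<and> ?h r = T. ?g r) = (\<Prod>v\<in>T - {i}. x v)"
      using pq by (simp add: field_simps)
  qed
  finally show ?thesis .
qed

lemma clique_tensor_row:
  assumes "finite (vertex_set G)"
  shows "(\<Sum>j\<in>vertex_set G. \<Sum>k\<in>vertex_set G. clique_tensor3 G i j k * x j * x k) = link_sum G i x"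
  using tensor_row_eq_link_sum[OF assms, of i x] by (simp add: clique_tensor3_def)

text \<open>Euler's identity for the homogeneous cubic form.\<close>

lemma sum_mult_link_sum:
  fixes x :: "'a \<Rightarrow> 'b::comm_semiring_1"
  assumes "finite (vertex_set G)"
  shows "(\<Sum>i\<in>vertex_set G. x i * link_sum G i x) = 3 * triangle_sum G x"
proof -
  let ?V = "vertex_set G"
  have "(\<Sum>i\<in>?V. x i * link_sum G i x)
      = (\<Sum>i\<in>?V. \<Sum>T | T \<in> triangles G \<and> i \<in> T. \<Prod>v\<in>T. x v)"
    unfolding link_sum_def sum_distrib_left
    by (intro sum.cong) (auto simp: triangle_finite prod.remove)
  also have "\<dots> = (\<Sum>T\<in>triangles G. \<Sum>i | i \<in> ?V \<and> i \<in> T. \<Prod>v\<in>T. x v)"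
    using assms finite_triangles[OF assms] by (rule sum.swap_restrict)
  also have "\<dots> = (\<Sum>T\<in>triangles G. 3 * (\<Prod>v\<in>T. x v))"
  proof (rule sum.cong[OF refl])
    fix T assume T: "T \<in> triangles G"
    then have "{i. i \<in> ?V \<and> i \<in> T} = T" using triangle_subset by blast
    then show "(\<Sum>i | i \<in> ?V \<and> i \<in> T. \<Prod>v\<in>T. x v) = 3 * (\<Prod>v\<in>T. x v)"
      by (simp add: triangle_card[OF T])
  qed
  finally show ?thesis by (simp add: triangle_sum_def sum_distrib_left)
qed

lemma triangle_sum_nonneg:
  fixes x :: "'a \<Rightarrow> real"
  assumes "\<And>v. v \<in> vertex_set G \<Longrightarrow> 0 \<le> x v"
  shows "0 \<le> triangle_sum G x"
  unfolding triangle_sum_def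
  by (intro sum_nonneg prod_nonneg) (use assms triangle_subset in blast)

lemma triangle_sum_cong:
  "(\<And>v. v \<in> vertex_set G \<Longrightarrow> x v = y v) \<Longrightarrow> triangle_sum G x = triangle_sum G y"
  unfolding triangle_sum_def
  by (intro sum.cong prod.cong refl) (use triangle_subset in blast)

lemma triangle_sum_scale:
  "triangle_sum G (\<lambda>v. c * x v) = c ^ 3 * triangle_sum G x"
  unfolding triangle_sum_def sum_distrib_left
  by (intro sum.cong) (auto simp: prod.distrib triangle_card)

text \<open>The form is multilinear, hence affine in each single coordinate; this is what makes the
  one-variable variation argument for the maximizer elementary.\<close>

lemma triangle_sum_upd:
  assumes "finite (vertex_set G)"
  shows "triangle_sum G (x(i := s)) =
    (\<Sum>T | T \<in> triangles G \<and> i \<notin> T. \<Prod>v\<in>T. x v) + s * link_sum G i x"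
proof -
  let ?y = "x(i := s)"
  have fin: "finite (triangles G)" using assms by (rule finite_triangles)
  have "triangle_sum G ?y = (\<Sum>T\<in>{T \<in> triangles G. i \<notin> T} \<union> {T \<in> triangles G. i \<in> T}. \<Prod>v\<in>T. ?y v)"
    unfolding triangle_sum_def by (rule sum.cong) auto
  also have "\<dots> = (\<Sum>T | T \<in> triangles G \<and> i \<notin> T. \<Prod>v\<in>T. ?y v)
      + (\<Sum>T | T \<in> triangles G \<and> i \<in> T. \<Prod>v\<in>T. ?y v)"
    using fin by (intro sum.union_disjoint) auto
  also have "(\<Sum>T | T \<in> triangles G \<and> i \<notin> T. \<Prod>v\<in>T. ?y v)
      = (\<Sum>T | T \<in> triangles G \<and> i \<notin> T. \<Prod>v\<in>T. x v)"
    by (intro sum.cong prod.cong) auto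
  also have "(\<Sum>T | T \<in> triangles G \<and> i \<in> T. \<Prod>v\<in>T. ?y v) = s * link_sum G i x"
    unfolding link_sum_def sum_distrib_left
  proof (rule sum.cong[OF refl])
    fix T assume "T \<in> {T. T \<in> triangles G \<and> i \<in> T}"
    then have "(\<Prod>v\<in>T. ?y v) = ?y i * (\<Prod>v\<in>T - {i}. ?y v)"
      by (intro prod.remove) (auto dest: triangle_finite)
    also have "(\<Prod>v\<in>T - {i}. ?y v) = (\<Prod>v\<in>T - {i}. x v)" by (intro prod.cong) auto
    finally show "(\<Prod>v\<in>T. ?y v) = s * (\<Prod>v\<in>T - {i}. x v)" by simp
  qed
  finally show ?thesis .
qed

lemma compact_PiE_real:
  "compact (PiE V (\<lambda>_. {a..b::real}) :: ('a \<Rightarrow> real) set)"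
proof -
  have "PiE V (\<lambda>_. {a..b::real}) = Pi UNIV (\<lambda>i. if i \<in> V then {a..b} else {undefined})"
    by (auto simp: PiE_def Pi_def extensional_def split: if_splits)
  moreover have "compactin (product_topology (\<lambda>_. euclideanreal) UNIV)
      (PiE UNIV (\<lambda>i. if i \<in> V then {a..b} else {undefined}))"
    by (subst compactin_PiE) auto
  ultimately show ?thesis
    by (simp add: euclidean_product_topology PiE_UNIV_domain)
qed

text \<open>Compactness gives a maximizer on the unit sphere of the 3-norm in the nonnegative orthant, and
  homogeneity turns maximality there into an inequality for all nonnegative vectors. Functions are
  restricted to \<open>vertex_set G\<close> so that the domain is a compact product of intervals.\<close>

lemma triangle_sum_has_maximizer:
  fixes G :: "'a sgraph"
  assumes fin: "finite (vertex_set G)" and ne: "vertex_set G \<noteq> {}"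
  obtains x :: "'a \<Rightarrow> real" where "\<And>v. v \<in> vertex_set G \<Longrightarrow> 0 \<le> x v"
    "(\<Sum>v\<in>vertex_set G. x v ^ 3) = 1"
    "\<And>y. (\<And>v. v \<in> vertex_set G \<Longrightarrow> 0 \<le> y v) \<Longrightarrow>
       triangle_sum G y \<le> triangle_sum G x * (\<Sum>v\<in>vertex_set G. y v ^ 3)"
proof -
  let ?V = "vertex_set G"
  let ?K = "PiE ?V (\<lambda>_. {0..1::real})"
  define S where "S = ?K \<inter> {x. (\<Sum>v\<in>?V. x v ^ 3) = 1}"
  have "closed {x :: 'a \<Rightarrow> real. (\<Sum>v\<in>?V. x v ^ 3) = 1}"
    by (intro closed_Collect_eq continuous_intros) auto
  then have S: "compact S" unfolding S_def by (intro compact_Int_closed compact_PiE_real)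
  obtain a where a: "a \<in> ?V" using ne by auto
  have "(\<lambda>v\<in>?V. if v = a then 1 else 0) \<in> S"
    unfolding S_def using a fin by (auto simp: if_distrib[of "\<lambda>z. z ^ 3"] cong: if_cong)
  then have Sne: "S \<noteq> {}" by auto
  have "continuous_on S (triangle_sum G :: ('a \<Rightarrow> real) \<Rightarrow> real)"
    unfolding triangle_sum_def
    by (intro continuous_intros continuous_on_subset[OF continuous_on_product_coordinates]) auto
  from continuous_attains_sup[OF S Sne this] obtain x where
    x: "x \<in> S" "\<And>y. y \<in> S \<Longrightarrow> triangle_sum G y \<le> triangle_sum G x" by auto
  show ?thesis
  proof (rule that[of x])
    show "0 \<le> x v" if "v \<in> ?V" for v using x(1) that by (auto simp: S_def PiE_def Pi_def)
    show "(\<Sum>v\<in>?V. x v ^ 3) = 1" using x(1) by (auto simp: S_def)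
  next
    fix y :: "'a \<Rightarrow> real" assume y: "\<And>v. v \<in> ?V \<Longrightarrow> 0 \<le> y v"
    define s where "s = (\<Sum>v\<in>?V. y v ^ 3)"
    have s0: "0 \<le> s" unfolding s_def using y by (intro sum_nonneg) auto
    show "triangle_sum G y \<le> triangle_sum G x * (\<Sum>v\<in>?V. y v ^ 3)"
    proof (cases "s = 0")
      case True
      then have "\<forall>v\<in>?V. y v ^ 3 = 0" unfolding s_def using y fin
        by (subst (asm) sum_nonneg_eq_0_iff) auto
      then have "triangle_sum G y = triangle_sum G (\<lambda>_. 0)"
        by (intro triangle_sum_cong) auto
      also have "\<dots> = 0" using triangle_sum_scale[of G 0 "\<lambda>_. 0"] by simp
      finally show ?thesis using True by (simp add: s_def)
    next
      case False
      define c where "c = root 3 s"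
      have c: "c > 0" "c ^ 3 = s" using s0 False by (auto simp: c_def real_root_pow_pos2)
      define z where "z = (\<lambda>v\<in>?V. y v / c)"
      have z3: "(\<Sum>v\<in>?V. z v ^ 3) = 1"
        using False c by (simp add: z_def power_divide sum_divide_distrib[symmetric] s_def)
      have "z v \<le> 1" if v: "v \<in> ?V" for v
      proof -
        have "z v ^ 3 \<le> (\<Sum>v\<in>?V. z v ^ 3)"
          using fin v y c by (intro member_le_sum) (auto simp: z_def)
        then show ?thesis using z3 by (metis one_le_power linorder_not_le power_le_one_iff
          not_less_iff_gr_or_eq less_le_trans power_one one_less_power zero_less_numeral)
      qed
      then have "z \<in> S" using z3 y c by (auto simp: S_def z_def)
      then have "triangle_sum G z \<le> triangle_sum G x" by (rule x(2))
      moreover have "triangle_sum G y = triangle_sum G (\<lambda>v. c * z v)"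
        using c by (intro triangle_sum_cong) (auto simp: z_def)
      ultimately show ?thesis
        using c s0 by (simp add: triangle_sum_scale s_def[symmetric] mult.commute mult_left_mono)
    qed
  qed
qed

text \<open>The first-order condition at a maximum over \<open>s \<ge> 0\<close>, including the boundary case \<open>t = 0\<close>, where
  it holds because the penalty \<open>m * s ^ 3\<close> has vanishing derivative. Comparing with the value at
  \<open>s = sqrt (q / m)\<close> avoids calculus.\<close>

lemma cubic_max_stationary:
  fixes t q m :: real
  assumes t: "0 \<le> t" and q: "0 \<le> q" and m: "0 \<le> m"
    and max: "\<And>s. 0 \<le> s \<Longrightarrow> 3 * s * q - m * s ^ 3 \<le> 3 * t * q - m * t ^ 3"
  shows "q = m * t\<^sup>2"
proof (cases "m = 0")
  case True
  with max[of "t + 1"] q t show ?thesis by (auto simp: algebra_simps)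
next
  case False
  define s where "s = sqrt (q / m)"
  have s: "0 \<le> s" "q = m * s\<^sup>2" using q m False by (auto simp: s_def)
  have "3 * s * q - m * s ^ 3 - (3 * t * q - m * t ^ 3) = m * ((s - t)\<^sup>2 * (2 * s + t))"
    unfolding s(2) by (simp add: algebra_simps power2_eq_square power3_eq_cube)
  with max[OF s(1)] have "m * ((s - t)\<^sup>2 * (2 * s + t)) \<le> 0" by simp
  then have "(s - t)\<^sup>2 * (2 * s + t) \<le> 0" using m False
    by (metis less_eq_real_def mult_le_0_iff not_le)
  moreover have "0 \<le> (s - t)\<^sup>2 * (2 * s + t)" using s t by simp
  ultimately have "(s - t)\<^sup>2 * (2 * s + t) = 0" by simp
  then have "s = t" using s t by auto
  with s(2) show ?thesis by simp
qed

lemma link_sum_nonneg: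
  fixes x :: "'a \<Rightarrow> real"
  assumes "\<And>v. v \<in> vertex_set G \<Longrightarrow> 0 \<le> x v"
  shows "0 \<le> link_sum G i x"
  unfolding link_sum_def
  by (intro sum_nonneg prod_nonneg) (use assms triangle_subset in blast)

text \<open>A Perron--Frobenius theorem. At a maximizer \<open>x\<close> of the form, varying one coordinate at
  a time yields the eigenvalue equation, so the maximum \<open>M\<close> is an eigenvalue. Conversely the moduli of
  any complex eigenvector satisfy the eigenvalue equation as an inequality, and pairing it with the
  moduli shows that no eigenvalue exceeds \<open>M\<close> in modulus. Hence the spectral radius is
  the maximum of a Rayleigh quotient; nothing below refers to complex eigenvectors again.\<close>

lemma mu3_attained:
  fixes G :: "'a sgraph"
  assumes fin: "finite (vertex_set G)" and ne: "vertex_set G \<noteq> {}"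
  obtains x :: "'a \<Rightarrow> real" where "\<And>v. v \<in> vertex_set G \<Longrightarrow> 0 \<le> x v"
    "(\<Sum>v\<in>vertex_set G. x v ^ 3) = 1"
    "mu3 G = 3 * triangle_sum G x"
    "\<And>y. (\<And>v. v \<in> vertex_set G \<Longrightarrow> 0 \<le> y v) \<Longrightarrow>
       3 * triangle_sum G y \<le> mu3 G * (\<Sum>v\<in>vertex_set G. y v ^ 3)"
proof -
  let ?V = "vertex_set G"
  obtain x :: "'a \<Rightarrow> real" where x0: "\<And>v. v \<in> ?V \<Longrightarrow> 0 \<le> x v"
    and x1: "(\<Sum>v\<in>?V. x v ^ 3) = 1"
    and max: "\<And>y. (\<And>v. v \<in> ?V \<Longrightarrow> 0 \<le> y v) \<Longrightarrow>
       triangle_sum G y \<le> triangle_sum G x * (\<Sum>v\<in>?V. y v ^ 3)"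
    using triangle_sum_has_maximizer[OF fin ne] by metis
  define M where "M = 3 * triangle_sum G x"
  have M0: "0 \<le> M" unfolding M_def using triangle_sum_nonneg[OF x0] by simp
  have crit: "link_sum G i x = M * (x i)\<^sup>2" if i: "i \<in> ?V" for i
  proof (rule cubic_max_stationary[OF x0[OF i] link_sum_nonneg M0])
    show "0 \<le> x v" if "v \<in> ?V" for v using that by (rule x0)
    fix s :: real assume s: "0 \<le> s"
    let ?R = "\<Sum>T | T \<in> triangles G \<and> i \<notin> T. \<Prod>v\<in>T. x v"
    have sum_upd: "(\<Sum>v\<in>?V. (x(i := r)) v ^ 3) = r ^ 3 + (\<Sum>v\<in>?V - {i}. x v ^ 3)" for r
      by (subst sum.remove[OF fin i]) (auto intro: sum.cong)
    have one: "x i ^ 3 + (\<Sum>v\<in>?V - {i}. x v ^ 3) = 1" using sum_upd[of "x i"] x1 by simp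
    have "3 * triangle_sum G (x(i := s)) \<le> M * (s ^ 3 + (\<Sum>v\<in>?V - {i}. x v ^ 3))"
      using max[of "x(i := s)"] x0 s unfolding M_def sum_upd by auto
    also have "\<dots> = M * (s ^ 3 + (1 - x i ^ 3))" by (simp add: one[symmetric])
    finally have "3 * (?R + s * link_sum G i x) \<le> M * (s ^ 3 + (1 - x i ^ 3))"
      by (simp add: triangle_sum_upd[OF fin])
    moreover have "M = 3 * (?R + x i * link_sum G i x)"
      using triangle_sum_upd[OF fin, of x i "x i"] by (simp add: M_def)
    ultimately show "3 * s * link_sum G i x - M * s ^ 3 \<le> 3 * x i * link_sum G i x - M * x i ^ 3"
      by (simp add: algebra_simps)
  qed
  have "tensor3_eigenvalue ?V (clique_tensor3 G) (of_real M)"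
    unfolding tensor3_eigenvalue_def
  proof (intro exI[of _ "\<lambda>v. of_real (x v)"] conjI ballI)
    show "\<exists>i\<in>?V. complex_of_real (x i) \<noteq> 0"
    proof (rule ccontr)
      assume "\<not> ?thesis"
      then have "(\<Sum>v\<in>?V. x v ^ 3) = 0" by (intro sum.neutral) auto
      with x1 show False by simp
    qed
    fix i assume i: "i \<in> ?V"
    have "link_sum G i (\<lambda>v. complex_of_real (x v)) = of_real (link_sum G i x)"
      by (simp add: link_sum_def)
    then show "(\<Sum>j\<in>?V. \<Sum>k\<in>?V. clique_tensor3 G i j k * of_real (x j) * of_real (x k))
        = of_real M * (of_real (x i))\<^sup>2"
      by (simp add: clique_tensor_row[OF fin] crit[OF i])
  qed
  moreover have "cmod l \<le> M" if l: "tensor3_eigenvalue ?V (clique_tensor3 G) l" for l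
  proof -
    from l obtain z where z: "\<exists>i\<in>?V. z i \<noteq> 0"
      and eig: "\<And>i. i \<in> ?V \<Longrightarrow> link_sum G i z = l * (z i)\<^sup>2"
      unfolding tensor3_eigenvalue_def by (auto simp: clique_tensor_row[OF fin])
    define y where "y = (\<lambda>v. cmod (z v))"
    have pos: "0 < (\<Sum>v\<in>?V. y v ^ 3)"
    proof -
      from z obtain i where "i \<in> ?V" "z i \<noteq> 0" by auto
      then show ?thesis using fin by (intro sum_pos2[of _ i]) (auto simp: y_def)
    qed
    have row: "cmod l * (y i)\<^sup>2 \<le> link_sum G i y" if "i \<in> ?V" for i
    proof -
      have "cmod l * (y i)\<^sup>2 = cmod (link_sum G i z)"
        by (simp add: eig[OF that] y_def norm_mult norm_power)
      also have "\<dots> \<le> link_sum G i y"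
        unfolding link_sum_def y_def by (rule order_trans[OF norm_sum]) (simp add: prod_norm)
      finally show ?thesis .
    qed
    have "cmod l * (\<Sum>v\<in>?V. y v ^ 3) = (\<Sum>v\<in>?V. y v * (cmod l * (y v)\<^sup>2))"
      by (simp add: sum_distrib_left power2_eq_square power3_eq_cube mult_ac)
    also have "\<dots> \<le> (\<Sum>v\<in>?V. y v * link_sum G v y)"
      by (intro sum_mono mult_left_mono row) (auto simp: y_def)
    also have "\<dots> = 3 * triangle_sum G y" by (rule sum_mult_link_sum[OF fin])
    also have "\<dots> \<le> M * (\<Sum>v\<in>?V. y v ^ 3)"
      using max[of y] by (simp add: M_def y_def)
    finally show ?thesis using pos by simp
  qed
  ultimately have "mu3 G = M"
    unfolding mu3_def tensor3_spectral_radius_def using M0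
    by (intro Greatest_equality) force+
  then show ?thesis
    using that[of x] x0 x1 max by (simp add: M_def)
qed

section \<open>Perron certificates and monotonicity\<close>

lemma mu3_le:
  fixes G :: "'a sgraph"
  assumes "finite (vertex_set G)" "vertex_set G \<noteq> {}"
    and "\<And>x :: 'a \<Rightarrow> real. (\<And>v. v \<in> vertex_set G \<Longrightarrow> 0 \<le> x v) \<Longrightarrow>
       3 * triangle_sum G x \<le> B * (\<Sum>v\<in>vertex_set G. x v ^ 3)"
  shows "mu3 G \<le> B"
proof -
  obtain x :: "'a \<Rightarrow> real" where "\<And>v. v \<in> vertex_set G \<Longrightarrow> 0 \<le> x v"
    "(\<Sum>v\<in>vertex_set G. x v ^ 3) = 1" "mu3 G = 3 * triangle_sum G x"
    using mu3_attained[OF assms(1,2)] by metis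
  with assms(3)[of x] show ?thesis by simp
qed

lemma mu3_ge:
  fixes x :: "'a \<Rightarrow> real"
  assumes "finite (vertex_set G)" "vertex_set G \<noteq> {}"
    and "\<And>v. v \<in> vertex_set G \<Longrightarrow> 0 \<le> x v" "\<exists>v\<in>vertex_set G. x v \<noteq> 0"
    and "B * (\<Sum>v\<in>vertex_set G. x v ^ 3) \<le> 3 * triangle_sum G x"
  shows "B \<le> mu3 G"
proof -
  have "3 * triangle_sum G x \<le> mu3 G * (\<Sum>v\<in>vertex_set G. x v ^ 3)"
    using mu3_attained[OF assms(1,2)] assms(3) by metis
  moreover obtain u where u: "u \<in> vertex_set G" "x u \<noteq> 0" using assms(4) by auto
  then have "0 < (\<Sum>v\<in>vertex_set G. x v ^ 3)"
    using assms(1,3) by (intro sum_pos2[of _ u]) (auto simp: less_le)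
  ultimately show ?thesis using assms(5) by (meson mult_le_cancel_right order_trans not_le)
qed

lemma mu3_nonneg:
  assumes "finite (vertex_set G)" "vertex_set G \<noteq> {}"
  shows "0 \<le> mu3 G"
  using assms triangle_sum_nonneg[of G "\<lambda>_. 1"] by (intro mu3_ge[where x = "\<lambda>_. 1"]) auto

text \<open>A maximizer for \<open>G\<close>, transported along \<open>f\<close> and extended by zero, is a test vector for \<open>H\<close>.\<close>

lemma mu3_mono_embedding:
  fixes G :: "'a sgraph" and H :: "'b sgraph"
  assumes G: "finite (vertex_set G)" "vertex_set G \<noteq> {}" and H: "finite (vertex_set H)"
    and f: "inj_on f (vertex_set G)" "f ` vertex_set G \<subseteq> vertex_set H"
    and tri: "\<And>T. T \<in> triangles G \<Longrightarrow> f ` T \<in> triangles H"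
  shows "mu3 G \<le> mu3 H"
proof -
  let ?V = "vertex_set G" and ?W = "vertex_set H"
  obtain x :: "'a \<Rightarrow> real" where x: "\<And>v. v \<in> ?V \<Longrightarrow> 0 \<le> x v"
    "(\<Sum>v\<in>?V. x v ^ 3) = 1" "mu3 G = 3 * triangle_sum G x"
    using mu3_attained[OF G] by metis
  define y where "y = (\<lambda>w. if w \<in> f ` ?V then x (the_inv_into ?V f w) else 0)"
  have yf: "y (f v) = x v" if "v \<in> ?V" for v
    using that f(1) by (simp add: y_def the_inv_into_f_f)
  have y0: "0 \<le> y w" for w using x(1) f(1) by (auto simp: y_def the_inv_into_f_f)
  have "(\<Sum>w\<in>?W. y w ^ 3) = (\<Sum>w\<in>f ` ?V. y w ^ 3)"
    using H f(2) by (intro sum.mono_neutral_right) (auto simp: y_def)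
  also have "\<dots> = (\<Sum>v\<in>?V. x v ^ 3)" by (simp add: sum.reindex[OF f(1)] yf)
  finally have y1: "(\<Sum>w\<in>?W. y w ^ 3) = 1" using x(2) by simp
  have inj: "inj_on ((`) f) (triangles G)"
    using f(1) by (intro inj_on_subset[OF inj_on_image_Pow]) (auto dest: triangle_subset)
  have "triangle_sum G x = (\<Sum>T\<in>triangles G. \<Prod>w\<in>f ` T. y w)"
    unfolding triangle_sum_def
  proof (rule sum.cong[OF refl])
    fix T assume "T \<in> triangles G"
    then have "inj_on f T" "T \<subseteq> ?V" using inj_on_subset[OF f(1)] triangle_subset by blast+
    then show "(\<Prod>v\<in>T. x v) = (\<Prod>w\<in>f ` T. y w)"
      by (auto simp: prod.reindex yf intro!: prod.cong)
  qed
  also have "\<dots> = (\<Sum>T\<in>(`) f ` triangles G. \<Prod>w\<in>T. y w)" by (simp add: sum.reindex[OF inj])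
  also have "\<dots> \<le> triangle_sum H y"
    unfolding triangle_sum_def using tri y0 finite_triangles[OF H]
    by (intro sum_mono2 prod_nonneg) auto
  finally have "triangle_sum G x \<le> triangle_sum H y" .
  moreover have "\<exists>w\<in>?W. y w \<noteq> 0"
  proof (rule ccontr)
    assume "\<not> ?thesis"
    then have "(\<Sum>w\<in>?W. y w ^ 3) = 0" by (intro sum.neutral) auto
    with y1 show False by simp
  qed
  ultimately show ?thesis
    using x(3) y1 y0 H G(2) f(2) by (intro mu3_ge[of H y]) auto
qed

lemma triangle_image_graph_embedding:
  assumes "T \<in> triangles G" "inj_on f (vertex_set G)" "f ` vertex_set G \<subseteq> vertex_set H"
    and "\<And>u v. {u, v} \<in> edge_set G \<Longrightarrow> u \<in> vertex_set G \<Longrightarrow> v \<in> vertex_set G \<Longrightarrow> {f u, f v} \<in> edge_set H"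
  shows "f ` T \<in> triangles H"
proof -
  have T: "T \<subseteq> vertex_set G" using assms(1) triangle_subset by blast
  have "card (f ` T) = 3"
    using card_image[OF inj_on_subset[OF assms(2) T]] triangle_card[OF assms(1)] by simp
  moreover have "{f u, f v} \<in> edge_set H" if "u \<in> T" "v \<in> T" "f u \<noteq> f v" for u v
    using that assms T by (force simp: triangles_def is_3clique_def)
  moreover have "f ` T \<subseteq> vertex_set H" using T assms(3) by blast
  ultimately show ?thesis by (auto simp: triangles_def is_3clique_def)
qed

lemma mu3_graph_iso:
  assumes "graph_iso G H" "finite (vertex_set G)" "vertex_set G \<noteq> {}"
  shows "mu3 G = mu3 H"
proof -
  obtain f where f: "bij_betw f (vertex_set G) (vertex_set H)"
    and e: "\<And>u v. u \<in> vertex_set G \<Longrightarrow> v \<in> vertex_set G \<Longrightarrow>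
      {u, v} \<in> edge_set G \<longleftrightarrow> {f u, f v} \<in> edge_set H"
    using assms(1) unfolding graph_iso_def by metis
  let ?g = "the_inv_into (vertex_set G) f"
  have g: "bij_betw ?g (vertex_set H) (vertex_set G)" using f by (rule bij_betw_the_inv_into)
  have fg: "f (?g w) = w" if "w \<in> vertex_set H" for w
    using f that by (auto simp: bij_betw_def f_the_inv_into_f)
  have gV: "?g w \<in> vertex_set G" if "w \<in> vertex_set H" for w
    using g that by (auto simp: bij_betw_def)
  have finH: "finite (vertex_set H)" "vertex_set H \<noteq> {}"
    using f assms(2,3) bij_betw_finite[OF f] by (auto simp: bij_betw_def)
  have "mu3 G \<le> mu3 H"
    using f assms(2,3) finH e
    by (intro mu3_mono_embedding[of G H f] triangle_image_graph_embedding) (auto simp: bij_betw_def)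
  moreover have "mu3 H \<le> mu3 G"
    using g assms(2,3) finH e[OF gV gV] fg
    by (intro mu3_mono_embedding[of H G ?g] triangle_image_graph_embedding) (auto simp: bij_betw_def)
  ultimately show ?thesis by simp
qed

lemma amgm_3:
  fixes a b c :: real
  assumes "0 \<le> a" "0 \<le> b" "0 \<le> c"
  shows "3 * (a * b * c) \<le> a ^ 3 + b ^ 3 + c ^ 3"
proof -
  have "a ^ 3 + b ^ 3 + c ^ 3 - 3 * (a * b * c)
      = (a + b + c) * ((a - b)\<^sup>2 + (b - c)\<^sup>2 + (c - a)\<^sup>2) / 2"
    by (simp add: algebra_simps power2_eq_square power3_eq_cube)
  also have "\<dots> \<ge> 0" using assms by simp
  finally show ?thesis by simp
qed

lemma amgm_card_3:
  fixes y :: "'a \<Rightarrow> real"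
  assumes "card T = 3" "\<And>v. v \<in> T \<Longrightarrow> 0 \<le> y v"
  shows "3 * (\<Prod>v\<in>T. y v) \<le> (\<Sum>v\<in>T. y v ^ 3)"
proof -
  obtain a b c where "T = {a, b, c}" "a \<noteq> b" "a \<noteq> c" "b \<noteq> c"
    using assms(1) by (auto simp: card_3_iff)
  then show ?thesis using amgm_3[of "y a" "y b" "y c"] assms(2) by (simp add: mult.assoc)
qed

text \<open>A positive vector \<open>r\<close> that satisfies the eigenvalue equation as an inequality for a family \<open>F\<close> of
  triples containing all triangles. The family is kept separate from \<open>triangles G\<close> so that the same
  vector, computed for an extremal graph, certifies the bound for every graph whose triangles
  form a subfamily.\<close>

locale perron_certificate =
  fixes G :: "'a sgraph" and F :: "'a set set" and r :: "'a \<Rightarrow> real" and l :: real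
  assumes fin: "finite (vertex_set G)" and nonempty: "vertex_set G \<noteq> {}"
    and F: "\<And>T. T \<in> F \<Longrightarrow> T \<subseteq> vertex_set G" "\<And>T. T \<in> F \<Longrightarrow> card T = 3"
    and triangles_F: "triangles G \<subseteq> F"
    and r_pos: "\<And>v. v \<in> vertex_set G \<Longrightarrow> 0 < r v"
    and row: "\<And>v. v \<in> vertex_set G \<Longrightarrow>
      (\<Sum>T | T \<in> F \<and> v \<in> T. \<Prod>u\<in>T - {v}. r u) \<le> l * (r v)\<^sup>2"
begin

text \<open>The bound that the arithmetic-geometric mean inequality puts on \<open>3 * (\<Prod>v\<in>T. x v)\<close> after
  rescaling every coordinate by \<open>r\<close>.\<close>

definition weight :: "('a \<Rightarrow> real) \<Rightarrow> 'a set \<Rightarrow> real" where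
  "weight x T = (\<Prod>u\<in>T. r u) * (\<Sum>v\<in>T. (x v / r v) ^ 3)"

lemma finite_F: "finite F"
  using fin F(1) by (intro finite_subset[of F "Pow (vertex_set G)"]) auto

lemma prod_r_pos: "T \<in> F \<Longrightarrow> 0 < (\<Prod>u\<in>T. r u)"
  using F(1) r_pos by (intro prod_pos) blast

lemma F_finite: "T \<in> F \<Longrightarrow> finite T"
  using F(2) by (metis card.infinite zero_neq_numeral)

lemma weight_nonneg:
  assumes "T \<in> F" "\<And>v. v \<in> vertex_set G \<Longrightarrow> 0 \<le> x v"
  shows "0 \<le> weight x T"
  unfolding weight_def using prod_r_pos[OF assms(1)] F(1)[OF assms(1)] assms(2) r_pos
  by (intro mult_nonneg_nonneg sum_nonneg) (auto simp: subset_iff less_imp_le)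

lemma weight_ge_prod:
  assumes T: "T \<in> F" and x: "\<And>v. v \<in> vertex_set G \<Longrightarrow> 0 \<le> x v"
  shows "3 * (\<Prod>v\<in>T. x v) \<le> weight x T"
proof -
  have eq: "(\<Prod>v\<in>T. x v) = (\<Prod>u\<in>T. r u) * (\<Prod>v\<in>T. x v / r v)"
    using prod_r_pos[OF T] by (simp add: prod_dividef)
  have "3 * (\<Prod>v\<in>T. x v / r v) \<le> (\<Sum>v\<in>T. (x v / r v) ^ 3)"
    using F[OF T] x r_pos by (intro amgm_card_3) (auto simp: subset_iff less_imp_le)
  then have "(\<Prod>u\<in>T. r u) * (3 * (\<Prod>v\<in>T. x v / r v)) \<le> weight x T"
    unfolding weight_def using prod_r_pos[OF T] by (intro mult_left_mono) auto
  then show ?thesis by (simp add: eq)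
qed

text \<open>Exchanging the order of summation collects at each vertex exactly the row sum that
  the certificate controls.\<close>

lemma sum_weight_le:
  assumes x: "\<And>v. v \<in> vertex_set G \<Longrightarrow> 0 \<le> x v"
  shows "(\<Sum>T\<in>F. weight x T) \<le> l * (\<Sum>v\<in>vertex_set G. x v ^ 3)"
proof -
  let ?V = "vertex_set G"
  have "(\<Sum>T\<in>F. weight x T) = (\<Sum>T\<in>F. \<Sum>v | v \<in> ?V \<and> v \<in> T. (\<Prod>u\<in>T. r u) * (x v / r v) ^ 3)"
  proof (rule sum.cong[OF refl])
    fix T assume "T \<in> F"
    then have "{v. v \<in> ?V \<and> v \<in> T} = T" using F(1) by blast
    then show "weight x T = (\<Sum>v | v \<in> ?V \<and> v \<in> T. (\<Prod>u\<in>T. r u) * (x v / r v) ^ 3)"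
      by (simp add: weight_def sum_distrib_left)
  qed
  also have "\<dots> = (\<Sum>v\<in>?V. \<Sum>T | T \<in> F \<and> v \<in> T. (\<Prod>u\<in>T. r u) * (x v / r v) ^ 3)"
    using finite_F fin by (rule sum.swap_restrict)
  also have "\<dots> \<le> (\<Sum>v\<in>?V. l * x v ^ 3)"
  proof (rule sum_mono)
    fix v assume v: "v \<in> ?V"
    have "(\<Sum>T | T \<in> F \<and> v \<in> T. (\<Prod>u\<in>T. r u) * (x v / r v) ^ 3)
        = (\<Sum>T | T \<in> F \<and> v \<in> T. (x v / r v) ^ 3 * r v * (\<Prod>u\<in>T - {v}. r u))"
      by (intro sum.cong) (auto simp: prod.remove[OF F_finite])
    also have "\<dots> = (x v / r v) ^ 3 * r v * (\<Sum>T | T \<in> F \<and> v \<in> T. \<Prod>u\<in>T - {v}. r u)"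
      by (simp add: sum_distrib_left)
    also have "\<dots> \<le> (x v / r v) ^ 3 * r v * (l * (r v)\<^sup>2)"
      using x[OF v] r_pos[OF v] row[OF v] by (intro mult_left_mono) auto
    also have "\<dots> = l * x v ^ 3"
      using r_pos[OF v] by (simp add: power2_eq_square power3_eq_cube field_simps)
    finally show "(\<Sum>T | T \<in> F \<and> v \<in> T. (\<Prod>u\<in>T. r u) * (x v / r v) ^ 3) \<le> l * x v ^ 3" .
  qed
  finally show ?thesis by (simp add: sum_distrib_left)
qed

lemma triangle_sum_split:
  "3 * triangle_sum G x = (\<Sum>T\<in>F. if T \<in> triangles G then 3 * (\<Prod>v\<in>T. x v) else 0)"
proof -
  have "(\<Sum>T\<in>F. if T \<in> triangles G then 3 * (\<Prod>v\<in>T. x v) else 0)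
      = (\<Sum>T\<in>triangles G. 3 * (\<Prod>v\<in>T. x v))"
    using triangles_F finite_F by (intro sum.mono_neutral_cong_right) auto
  then show ?thesis by (simp add: triangle_sum_def sum_distrib_left)
qed

lemma mu3_le_certificate: "mu3 G \<le> l"
proof (rule mu3_le[OF fin nonempty])
  fix x :: "'a \<Rightarrow> real" assume x: "\<And>v. v \<in> vertex_set G \<Longrightarrow> 0 \<le> x v"
  have "3 * triangle_sum G x \<le> (\<Sum>T\<in>F. weight x T)"
    unfolding triangle_sum_split
    by (intro sum_mono) (auto intro: weight_ge_prod weight_nonneg x)
  also have "\<dots> \<le> l * (\<Sum>v\<in>vertex_set G. x v ^ 3)" by (rule sum_weight_le[OF x])
  finally show "3 * triangle_sum G x \<le> l * (\<Sum>v\<in>vertex_set G. x v ^ 3)" .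
qed

text \<open>In case of equality every inequality \<open>weight_ge_prod\<close> is tight at the maximizer \<open>x\<close>, and so is
  every bound by zero for a triple that is not a triangle. So on each
  triple \<open>x\<close> is either entirely zero or entirely nonzero. By connectedness of \<open>F\<close> it
  is nonzero everywhere, and then no triple of \<open>F\<close> can be missing.\<close>

lemma triangles_eq_if_mu3_eq:
  assumes conn: "\<And>S. S \<subseteq> vertex_set G \<Longrightarrow> S \<noteq> {} \<Longrightarrow>
      (\<And>T. T \<in> F \<Longrightarrow> T \<inter> S = {} \<or> T \<subseteq> S) \<Longrightarrow> S = vertex_set G"
    and eq: "mu3 G = l"
  shows "triangles G = F"
proof (rule ccontr)
  assume "triangles G \<noteq> F"
  let ?V = "vertex_set G"
  obtain x :: "'a \<Rightarrow> real" where x: "\<And>v. v \<in> ?V \<Longrightarrow> 0 \<le> x v"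
    and x1: "(\<Sum>v\<in>?V. x v ^ 3) = 1" and mu: "mu3 G = 3 * triangle_sum G x"
    using mu3_attained[OF fin nonempty] by metis
  let ?p = "\<lambda>T. if T \<in> triangles G then 3 * (\<Prod>v\<in>T. x v) else 0"
  have le: "?p T \<le> weight x T" if "T \<in> F" for T
    using that by (auto intro: weight_ge_prod weight_nonneg x)
  have tight: "weight x T = ?p T" if T: "T \<in> F" for T
  proof (rule ccontr)
    assume "weight x T \<noteq> ?p T"
    then have "?p T < weight x T" using le[OF T] by simp
    then have "(\<Sum>T\<in>F. ?p T) < (\<Sum>T\<in>F. weight x T)"
      using le finite_F T by (intro sum_strict_mono_ex1 bexI[of _ T]) auto
    also have "\<dots> \<le> l" using sum_weight_le[of x] x x1 by simp
    finally show False using eq mu by (simp add: triangle_sum_split)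
  qed
  have zero: "x v = 0" if "T \<in> F" "v \<in> T" "T \<notin> triangles G \<or> (\<exists>u\<in>T. x u = 0)" for T v
  proof -
    have "weight x T = 0" using tight[OF that(1)] that(3) F_finite[OF that(1)] by auto
    then have "(\<Sum>v\<in>T. (x v / r v) ^ 3) = 0"
      using prod_r_pos[OF that(1)] by (simp add: weight_def)
    moreover have "\<forall>v\<in>T. 0 \<le> (x v / r v) ^ 3"
      using F(1)[OF that(1)] x r_pos by (auto simp: subset_iff less_imp_le)
    ultimately have "(x v / r v) ^ 3 = 0"
      using that(2) F_finite[OF that(1)] by (simp add: sum_nonneg_eq_0_iff)
    then show ?thesis using F(1)[OF that(1)] that(2) r_pos[of v] by auto
  qed
  define S where "S = {v \<in> ?V. x v \<noteq> 0}"
  have "S \<noteq> {}"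
  proof
    assume "S = {}"
    then have "(\<Sum>v\<in>?V. x v ^ 3) = 0" by (intro sum.neutral) (auto simp: S_def)
    with x1 show False by simp
  qed
  moreover have "T \<inter> S = {} \<or> T \<subseteq> S" if "T \<in> F" for T
    using zero[OF that] F(1)[OF that] by (auto simp: S_def)
  ultimately have "S = ?V" by (intro conn) (auto simp: S_def)
  moreover obtain T where T: "T \<in> F" "T \<notin> triangles G"
    using \<open>triangles G \<noteq> F\<close> triangles_F by auto
  moreover obtain v where "v \<in> T" using F(2)[OF T(1)] by fastforce
  ultimately show False using zero[of T v] F(1)[OF T(1)] by (auto simp: S_def)
qed

end

text \<open>For an exact eigenvector the certificate is sharp, the vector itself being a test vector.\<close>

lemma mu3_eq_certificate:
  assumes "perron_certificate G (triangles G) r l"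
    and tight: "\<And>v. v \<in> vertex_set G \<Longrightarrow> link_sum G v r = l * (r v)\<^sup>2"
  shows "mu3 G = l"
proof -
  interpret perron_certificate G "triangles G" r l by fact
  have "3 * triangle_sum G r = (\<Sum>v\<in>vertex_set G. r v * (l * (r v)\<^sup>2))"
    by (simp add: sum_mult_link_sum[OF fin, symmetric] tight)
  also have "\<dots> = l * (\<Sum>v\<in>vertex_set G. r v ^ 3)"
    by (simp add: sum_distrib_left power2_eq_square power3_eq_cube mult_ac)
  finally have "l \<le> mu3 G"
    using r_pos nonempty by (intro mu3_ge[OF fin nonempty, of r]) (auto simp: less_imp_le)
  with mu3_le_certificate show ?thesis by simp
qed

section \<open>Lagrangian bounds and weighted Mantel\<close>

text \<open>The power mean inequality, by comparing each \<open>a i ^ 3\<close> with its tangent at the mean.\<close>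

lemma sum_cubed_le:
  fixes a :: "'i \<Rightarrow> real"
  assumes "finite A" "\<And>i. i \<in> A \<Longrightarrow> 0 \<le> a i"
  shows "(\<Sum>i\<in>A. a i) ^ 3 \<le> (real (card A))\<^sup>2 * (\<Sum>i\<in>A. a i ^ 3)"
proof (cases "A = {}")
  case False
  define t where "t = real (card A)"
  define m where "m = (\<Sum>i\<in>A. a i) / t"
  have t: "0 < t" using False assms(1) by (simp add: t_def card_gt_0_iff)
  have m: "0 \<le> m" unfolding m_def using assms(2) t by (intro divide_nonneg_pos sum_nonneg) auto
  have tangent: "3 * m\<^sup>2 * a i - 2 * m ^ 3 \<le> a i ^ 3" if "i \<in> A" for i
    using amgm_3[of m m "a i"] m assms(2)[OF that] by (simp add: power2_eq_square power3_eq_cube)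
  have "(\<Sum>i\<in>A. a i) ^ 3 = t\<^sup>2 * (t * m ^ 3)"
    using t by (simp add: m_def power2_eq_square power3_eq_cube)
  also have "t * m ^ 3 = (\<Sum>i\<in>A. 3 * m\<^sup>2 * a i - 2 * m ^ 3)"
  proof -
    have "(\<Sum>i\<in>A. a i) = t * m" using t by (simp add: m_def)
    then show ?thesis
      by (simp add: sum_subtractf sum_distrib_left[symmetric] t_def[symmetric]
          power2_eq_square power3_eq_cube)
  qed
  also have "t\<^sup>2 * \<dots> \<le> t\<^sup>2 * (\<Sum>i\<in>A. a i ^ 3)"
    by (intro mult_left_mono sum_mono tangent) auto
  finally show ?thesis by (simp add: t_def)
qed simp

text \<open>With \<open>z v = x v ^ 3\<close> the power mean inequality replaces the spectral problem by the
  Lagrangian, the maximum of the cubic form on the simplex, at the cost of counting triangles. For \<open>K\<^sub>1 \<or> T\<^sub>2\<close>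
  both steps are equalities.\<close>

lemma mu3_cubed_le:
  fixes G :: "'a sgraph"
  assumes fin: "finite (vertex_set G)" and ne: "vertex_set G \<noteq> {}"
    and lagrangian: "\<And>z :: 'a \<Rightarrow> real. (\<And>v. v \<in> vertex_set G \<Longrightarrow> 0 \<le> z v) \<Longrightarrow>
      (\<Sum>v\<in>vertex_set G. z v) = 1 \<Longrightarrow> triangle_sum G z \<le> L"
  shows "mu3 G ^ 3 \<le> 27 * L * (real (card (triangles G)))\<^sup>2"
proof -
  obtain x :: "'a \<Rightarrow> real" where x: "\<And>v. v \<in> vertex_set G \<Longrightarrow> 0 \<le> x v"
    and x1: "(\<Sum>v\<in>vertex_set G. x v ^ 3) = 1" and mu: "mu3 G = 3 * triangle_sum G x"
    using mu3_attained[OF fin ne] by metis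
  let ?t = "real (card (triangles G))"
  have "triangle_sum G x ^ 3 \<le> ?t\<^sup>2 * (\<Sum>T\<in>triangles G. (\<Prod>v\<in>T. x v) ^ 3)"
    unfolding triangle_sum_def
    by (intro sum_cubed_le finite_triangles fin prod_nonneg) (use x triangle_subset in blast)
  also have "(\<Sum>T\<in>triangles G. (\<Prod>v\<in>T. x v) ^ 3) = triangle_sum G (\<lambda>v. x v ^ 3)"
    by (simp add: triangle_sum_def prod_power_distrib)
  also have "?t\<^sup>2 * \<dots> \<le> ?t\<^sup>2 * L"
    using lagrangian[of "\<lambda>v. x v ^ 3"] x x1 by (intro mult_left_mono) auto
  finally show ?thesis by (simp add: mu power_mult_distrib mult.commute)
qed

text \<open>The expansion of \<open>(\<Sum>v. z v) ^ 3\<close> contains each triangle product six times.\<close>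

lemma triangle_sum_le_sixth:
  fixes z :: "'a \<Rightarrow> real"
  assumes fin: "finite (vertex_set G)" and z: "\<And>v. v \<in> vertex_set G \<Longrightarrow> 0 \<le> z v"
    and z1: "(\<Sum>v\<in>vertex_set G. z v) = 1"
  shows "triangle_sum G z \<le> 1 / 6"
proof -
  let ?V = "vertex_set G"
  have "link_sum G i z \<le> 1 / 2" for i
  proof -
    have "link_sum G i z \<le> (\<Sum>j\<in>?V. \<Sum>k\<in>?V. 1 / 2 * z j * z k)"
      unfolding tensor_row_eq_link_sum[OF fin, symmetric]
      using z by (intro sum_mono mult_right_mono) auto
    also have "\<dots> = 1 / 2 * (\<Sum>j\<in>?V. z j) * (\<Sum>k\<in>?V. z k)"
      by (simp add: sum_distrib_left sum_distrib_right mult_ac)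
    finally show ?thesis using z1 by simp
  qed
  then have "3 * triangle_sum G z \<le> (\<Sum>i\<in>?V. z i * (1 / 2))"
    unfolding sum_mult_link_sum[OF fin, symmetric] using z by (intro sum_mono mult_left_mono) auto
  also have "\<dots> = 1 / 2" using z1 by (simp add: sum_divide_distrib[symmetric])
  finally show ?thesis by simp
qed

text \<open>Crude, but sufficient to dispose of graphs with linearly many triangles.\<close>

lemma mu3_cubed_le_card_triangles:
  assumes "finite (vertex_set G)" "vertex_set G \<noteq> {}"
  shows "mu3 G ^ 3 \<le> 9 / 2 * (real (card (triangles G)))\<^sup>2"
  using mu3_cubed_le[OF assms, of "1 / 6"] triangle_sum_le_sixth[OF assms(1)] by simp

text \<open>In a triangle-free relation every neighbourhood is independent; take one of maximal weight.\<close>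

lemma heavy_neighbourhood:
  fixes z :: "'a \<Rightarrow> real" and R :: "'a \<Rightarrow> 'a \<Rightarrow> bool"
  assumes fin: "finite U"
    and triangle_free: "\<forall>i j k. R i j \<longrightarrow> R j k \<longrightarrow> \<not> R i k"
  shows "\<exists>N \<subseteq> U. (\<forall>i\<in>N. \<forall>j\<in>N. \<not> R i j) \<and>
    (\<forall>i\<in>U. (\<Sum>j | j \<in> U \<and> R i j. z j) \<le> (\<Sum>j\<in>N. z j))"
proof (cases "U = {}")
  case False
  let ?D = "\<lambda>i. \<Sum>j | j \<in> U \<and> R i j. z j"
  obtain i0 where i0: "i0 \<in> U" "\<And>i. i \<in> U \<Longrightarrow> ?D i \<le> ?D i0"
  proof -
    have "Max (?D ` U) \<in> ?D ` U" using fin False by (intro Max_in) auto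
    then obtain i0 where "i0 \<in> U" "?D i0 = Max (?D ` U)" by (auto simp del: Max_in)
    moreover have "?D i \<le> Max (?D ` U)" if "i \<in> U" for i using fin that by (intro Max_ge) auto
    ultimately show ?thesis using that[of i0] by simp
  qed
  show ?thesis
    by (rule exI[of _ "{j \<in> U. R i0 j}"]) (use i0 triangle_free in auto)
qed auto

text \<open>The weighted form of Mantel's theorem (Motzkin and Straus). Every edge meets the complement \<open>C\<close> of a heaviest
  neighbourhood \<open>N\<close>, so the edges are covered by the stars at \<open>C\<close>, each of
  weight at most that of \<open>N\<close>.\<close>

lemma weighted_mantel:
  fixes z :: "'a \<Rightarrow> real"
  assumes fin: "finite U" and z: "\<And>i. i \<in> U \<Longrightarrow> 0 \<le> z i"
    and sym: "\<And>i j. R i j \<Longrightarrow> R j i"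
    and triangle_free: "\<forall>i j k. R i j \<longrightarrow> R j k \<longrightarrow> \<not> R i k"
  shows "(\<Sum>i\<in>U. z i * (\<Sum>j | j \<in> U \<and> R i j. z j)) \<le> (\<Sum>i\<in>U. z i)\<^sup>2 / 2"
proof -
  let ?D = "\<lambda>i. \<Sum>j | j \<in> U \<and> R i j. z j"
  obtain N where N: "N \<subseteq> U" and indep: "\<And>i j. i \<in> N \<Longrightarrow> j \<in> N \<Longrightarrow> \<not> R i j"
    and D: "\<And>i. i \<in> U \<Longrightarrow> ?D i \<le> (\<Sum>j\<in>N. z j)"
    using heavy_neighbourhood[of U R z, OF fin triangle_free] by blast
  define C where "C = U - N"
  have fNC: "finite N" "finite C" using fin N by (auto simp: C_def finite_subset)
  have split: "(\<Sum>i\<in>U. f i) = (\<Sum>i\<in>N. f i) + (\<Sum>i\<in>C. f i)" for f :: "'a \<Rightarrow> real"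
    using fNC N by (subst sum.union_disjoint[symmetric]) (auto simp: C_def intro!: sum.cong)
  have "(\<Sum>i\<in>N. z i * ?D i) = (\<Sum>i\<in>N. \<Sum>j | j \<in> C \<and> R i j. z i * z j)"
    unfolding sum_distrib_left
  proof (intro sum.cong refl)
    fix i assume "i \<in> N"
    then show "{j. j \<in> U \<and> R i j} = {j. j \<in> C \<and> R i j}" using indep[of i] by (auto simp: C_def)
  qed
  also have "\<dots> = (\<Sum>j\<in>C. \<Sum>i | i \<in> N \<and> R i j. z i * z j)"
    using fNC by (rule sum.swap_restrict)
  also have "\<dots> \<le> (\<Sum>j\<in>C. z j * ?D j)"
  proof (rule sum_mono)
    fix j assume "j \<in> C"
    then have j: "j \<in> U" by (simp add: C_def)
    have "(\<Sum>i | i \<in> N \<and> R i j. z i * z j) \<le> (\<Sum>i | i \<in> U \<and> R j i. z i * z j)"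
      using fin N sym z j by (intro sum_mono2) auto
    then show "(\<Sum>i | i \<in> N \<and> R i j. z i * z j) \<le> z j * ?D j"
      by (simp add: sum_distrib_left mult.commute)
  qed
  \<comment> \<open>An edge at \<open>N\<close> has its other end in \<open>C\<close>, so half of the double sum is already bounded by the sum over \<open>C\<close>.\<close>
  finally have NC: "(\<Sum>i\<in>N. z i * ?D i) \<le> (\<Sum>j\<in>C. z j * ?D j)" .
  have C: "(\<Sum>j\<in>C. z j * ?D j) \<le> (\<Sum>j\<in>C. z j) * (\<Sum>j\<in>N. z j)"
    unfolding sum_distrib_right using z D by (intro sum_mono mult_left_mono) (auto simp: C_def)
  have "(\<Sum>i\<in>U. z i * ?D i) \<le> 2 * ((\<Sum>j\<in>C. z j) * (\<Sum>j\<in>N. z j))"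
    using NC C by (simp add: split)
  also have "\<dots> \<le> ((\<Sum>j\<in>N. z j) + (\<Sum>j\<in>C. z j))\<^sup>2 / 2"
    using zero_le_power2[of "(\<Sum>j\<in>N. z j) - (\<Sum>j\<in>C. z j)"]
    by (simp add: power2_eq_square algebra_simps)
  finally show ?thesis by (simp add: split)
qed

lemma mult_le_square_div_4:
  fixes a b :: nat
  shows "a * b \<le> (a + b)\<^sup>2 div 4"
proof -
  have "4 * (a * b) \<le> (a + b)\<^sup>2"
  proof -
    have "0 \<le> (int a - int b)\<^sup>2" by simp
    then have "int (4 * (a * b)) \<le> int ((a + b)\<^sup>2)" by (simp add: power2_eq_square algebra_simps)
    then show ?thesis by linarith
  qed
  then show ?thesis by linarith
qed

text \<open>If the number of edges reaches \<open>(card U)\<^sup>2 div 4\<close>, all estimates in the proof of Mantel's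
  theorem are equalities, which forces every element of \<open>N\<close> to be adjacent to all of \<open>C\<close> and to
  nothing else, and vice versa.\<close>

lemma mantel_equality:
  assumes fin: "finite U"
    and sym: "\<forall>i j. R i j \<longrightarrow> R j i"
    and triangle_free: "\<forall>i j k. R i j \<longrightarrow> R j k \<longrightarrow> \<not> R i k"
    and many: "2 * ((card U)\<^sup>2 div 4) \<le> (\<Sum>i\<in>U. card {j \<in> U. R i j})"
  obtains N C where "N \<union> C = U" "N \<inter> C = {}" "card N * card C = (card U)\<^sup>2 div 4"
    "\<And>i j. i \<in> U \<Longrightarrow> j \<in> U \<Longrightarrow> R i j \<longleftrightarrow> (i \<in> N) \<noteq> (j \<in> N)"
proof -
  let ?d = "\<lambda>i. card {j \<in> U. R i j}"
  obtain N where N: "N \<subseteq> U" and indep: "\<And>i j. i \<in> N \<Longrightarrow> j \<in> N \<Longrightarrow> \<not> R i j"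
    and D: "\<And>i. i \<in> U \<Longrightarrow> (\<Sum>j | j \<in> U \<and> R i j. 1 :: real) \<le> (\<Sum>j\<in>N. 1)"
    using heavy_neighbourhood[of U R "\<lambda>_. 1", OF fin triangle_free] by blast
  have dN: "?d i \<le> card N" if "i \<in> U" for i using D[OF that] by simp
  define C where "C = U - N"
  have fNC: "finite N" "finite C" using fin N by (auto simp: C_def finite_subset)
  have U: "N \<union> C = U" "N \<inter> C = {}" using N by (auto simp: C_def)
  have cardU: "card U = card N + card C" using card_Un_disjoint[OF fNC U(2)] U(1) by simp
  have subC: "{j \<in> U. R i j} \<subseteq> C" if "i \<in> N" for i using indep[OF that] by (auto simp: C_def)
  have dC: "?d i \<le> card C" if "i \<in> N" for i by (rule card_mono[OF fNC(2) subC[OF that]])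
  have split: "(\<Sum>i\<in>U. ?d i) = (\<Sum>i\<in>N. ?d i) + (\<Sum>i\<in>C. ?d i)"
    using sum.union_disjoint[OF fNC U(2), of ?d] U(1) by simp
  have le1: "(\<Sum>i\<in>N. ?d i) \<le> card N * card C"
    using sum_bounded_above[of N ?d "card C"] dC by simp
  have le2: "(\<Sum>i\<in>C. ?d i) \<le> card C * card N"
    using sum_bounded_above[of C ?d "card N"] dN by (simp add: C_def)
  have prod: "card N * card C \<le> (card U)\<^sup>2 div 4"
    unfolding cardU by (rule mult_le_square_div_4)
  have eq: "card N * card C = (card U)\<^sup>2 div 4" "(\<Sum>i\<in>N. ?d i) = card N * card C"
    "(\<Sum>i\<in>C. ?d i) = card C * card N"
    using many le1 le2 prod unfolding split by (simp_all add: mult.commute[of "card C"])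
  have full: "{j \<in> U. R i j} = C" if i: "i \<in> N" for i
  proof (rule card_subset_eq[OF fNC(2) subC[OF i]])
    show "?d i = card C"
    proof (rule ccontr)
      assume "?d i \<noteq> card C"
      then have "(\<Sum>i\<in>N. ?d i) < (\<Sum>i\<in>N. card C)"
        using dC i fNC by (intro sum_strict_mono_ex1 bexI[of _ i]) (auto simp: less_le)
      with eq show False by simp
    qed
  qed
  have full': "{j \<in> U. R i j} = N" if i: "i \<in> C" for i
  proof -
    have iU: "i \<in> U" using i by (simp add: C_def)
    have "N \<subseteq> {j \<in> U. R i j}" using full i N sym by blast
    moreover have "?d i \<le> card N" by (rule dN[OF iU])
    ultimately show ?thesis using card_seteq[of "{j \<in> U. R i j}" N] fin by simp
  qed
  show ?thesis
  proof (rule that[OF U eq(1)])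
    fix i j assume "i \<in> U" "j \<in> U"
    then show "R i j \<longleftrightarrow> (i \<in> N) \<noteq> (j \<in> N)"
      using full[of i] full'[of i] by (auto simp: C_def)
  qed
qed

section \<open>Structure of intersecting triangle families\<close>

definition clique :: "'a sgraph \<Rightarrow> 'a set \<Rightarrow> bool" where
  "clique G S \<longleftrightarrow> S \<subseteq> vertex_set G \<and> (\<forall>u\<in>S. \<forall>v\<in>S. u \<noteq> v \<longrightarrow> {u, v} \<in> edge_set G)"

lemma triangles_iff_clique: "T \<in> triangles G \<longleftrightarrow> clique G T \<and> card T = 3"
  by (auto simp: triangles_def is_3clique_def clique_def)

lemma clique_subset: "clique G S \<Longrightarrow> S' \<subseteq> S \<Longrightarrow> clique G S'"
  unfolding clique_def by blast

lemma clique_insert: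
  "clique G (insert w S) \<longleftrightarrow>
    clique G S \<and> w \<in> vertex_set G \<and> (\<forall>k\<in>S. k \<noteq> w \<longrightarrow> {w, k} \<in> edge_set G)"
  by (auto simp: clique_def insert_commute)

lemma triangle_edge:
  "T \<in> triangles G \<Longrightarrow> u \<in> T \<Longrightarrow> v \<in> T \<Longrightarrow> u \<noteq> v \<Longrightarrow> {u, v} \<in> edge_set G"
  by (auto simp: triangles_iff_clique clique_def)

lemma card_3_two_members:
  assumes "card T = 3" "p \<in> T" "q \<in> T" "p \<noteq> q"
  obtains r where "T = {p, q, r}" "r \<noteq> p" "r \<noteq> q"
proof -
  have "card (T - {p, q}) = 1"
    using assms card_Diff_subset[of "{p, q}" T] by simp
  then obtain r where "T - {p, q} = {r}" by (auto simp: card_1_singleton_iff)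
  then show ?thesis using assms by (intro that[of r]) auto
qed

lemma two_disjoint_triangles_copy:
  assumes T: "T1 \<in> triangles G" "T2 \<in> triangles G" "T1 \<inter> T2 = {}"
  shows "contains_copy G (copies 2 (complete_graph 3))"
proof -
  obtain g1 g2 where g: "bij_betw g1 {..<3::nat} T1" "bij_betw g2 {..<3::nat} T2"
    using ex_bij_betw_nat_finite[OF triangle_finite[OF T(1)]]
      ex_bij_betw_nat_finite[OF triangle_finite[OF T(2)]]
      triangle_card[OF T(1)] triangle_card[OF T(2)] by (auto simp: atLeast0LessThan)
  define f where "f = (\<lambda>(i::nat, k). if i = 0 then g1 k else g2 k)"
  have mem: "g1 k \<in> T1" "g2 k \<in> T2" if "k < 3" for k
    using g that by (auto simp: bij_betw_def)
  have inj: "g1 k = g1 k' \<longleftrightarrow> k = k'" "g2 k = g2 k' \<longleftrightarrow> k = k'" if "k < 3" "k' < 3" for k k'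
    using g that by (auto simp: bij_betw_def inj_on_def)
  show ?thesis
    unfolding contains_copy_def
  proof (intro exI[of _ f] conjI ballI)
    show "inj_on f (vertex_set (copies 2 (complete_graph 3)))"
      using T(3) mem inj
      by (auto simp: inj_on_def f_def copies_def complete_graph_def less_2_cases_iff
          split: if_splits) (metis disjoint_iff)+
    show "f ` vertex_set (copies 2 (complete_graph 3)) \<subseteq> vertex_set G"
      using subsetD[OF triangle_subset[OF T(1)] mem(1)] subsetD[OF triangle_subset[OF T(2)] mem(2)]
      by (auto simp: f_def copies_def complete_graph_def split: if_splits)
    fix e assume "e \<in> edge_set (copies 2 (complete_graph 3))"
    then obtain i a b where e: "e = {(i, a), (i, b)}" "a < 3" "b < 3" "a \<noteq> b"
      by (auto simp: copies_def complete_graph_def card_2_iff)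
    then show "f ` e \<in> edge_set G"
      using triangle_edge[OF T(1)] triangle_edge[OF T(2)] mem inj by (auto simp: f_def)
  qed
qed

locale intersecting_triangles =
  fixes G :: "'a sgraph"
  assumes fin: "finite (vertex_set G)"
    and meet: "\<And>T T'. T \<in> triangles G \<Longrightarrow> T' \<in> triangles G \<Longrightarrow> T \<inter> T' \<noteq> {}"
begin

text \<open>Three vertices of the clique outside \<open>T\<close> would form a triangle disjoint from \<open>T\<close>.\<close>

lemma clique_meets_triangle:
  assumes Q: "clique G Q" and T: "T \<in> triangles G"
  shows "card Q \<le> card (T \<inter> Q) + 2"
proof (rule ccontr)
  assume "\<not> ?thesis"
  moreover have fQ: "finite Q" using Q fin by (auto simp: clique_def finite_subset)
  moreover have "card Q = card (T \<inter> Q) + card (Q - T)"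
    using card_Int_Diff[OF fQ, of T] by (simp add: Int_commute)
  ultimately have "3 \<le> card (Q - T)" by simp
  then obtain S where "S \<subseteq> Q - T" "card S = 3" by (meson obtain_subset_with_card_n)
  then have "S \<in> triangles G" "T \<inter> S = {}"
    using clique_subset[OF Q] by (auto simp: triangles_iff_clique)
  with meet[OF T] show False by blast
qed

text \<open>Every triangle has at least two vertices in the four-clique \<open>K\<close>, so everything depends on how many
  neighbours in \<open>K\<close> an outside vertex \<open>w\<close> has. Four neighbours give \<open>K\<^sub>5\<close>, which then
  absorbs all triangles. With exactly three neighbours \<open>A\<close>, both \<open>K\<close> and \<open>insert w A\<close> are
  four-cliques, and a triangle meeting \<open>A\<close> only once would need the missing edge between them. If all have at
  most two, each outside vertex lies in at most one triangle.\<close>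

lemma structure_with_K4:
  assumes K: "clique G K" "card K = 4"
  shows "(\<exists>A\<in>triangles G. \<forall>T\<in>triangles G. 2 \<le> card (T \<inter> A)) \<or>
    (\<exists>Q. clique G Q \<and> card Q = 5 \<and> (\<forall>T\<in>triangles G. T \<subseteq> Q)) \<or>
    card (triangles G) \<le> card (vertex_set G)"
proof -
  let ?V = "vertex_set G"
  have KV: "K \<subseteq> ?V" "finite K" using K(1) fin by (auto simp: clique_def finite_subset)
  define N where "N w = {k \<in> K. {w, k} \<in> edge_set G}" for w
  have fN: "finite (N w)" for w using KV(2) by (simp add: N_def)
  consider (K5) w where "w \<in> ?V - K" "N w = K"
    | (core) w A where "w \<in> ?V - K" "A \<subseteq> N w" "card A = 3" "N w \<noteq> K"
    | (pages) "\<forall>w\<in>?V - K. card (N w) \<le> 2"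
    using obtain_subset_with_card_n[of 3] by (metis not_less_eq_eq numeral_3_eq_3 numeral_2_eq_2)
  then show ?thesis
  proof cases
    case K5
    let ?Q = "insert w K"
    have Q: "clique G ?Q" using K K5 by (auto simp: clique_insert N_def)
    have cQ: "card ?Q = 5" using K(2) KV K5 by simp
    have "T \<subseteq> ?Q" if T: "T \<in> triangles G" for T
    proof -
      have "3 \<le> card (T \<inter> ?Q)" using clique_meets_triangle[OF Q T] cQ by simp
      then have "T \<inter> ?Q = T"
        using card_seteq[of T "T \<inter> ?Q"] triangle_finite[OF T] triangle_card[OF T] by auto
      then show ?thesis by blast
    qed
    with Q cQ show ?thesis by blast
  next
    case core
    have AK: "A \<subseteq> K" using core(2) by (auto simp: N_def)
    have A: "A \<in> triangles G" using clique_subset[OF K(1) AK] core(3) by (simp add: triangles_iff_clique)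
    have "card (K - A) = 1" using AK K(2) core(3) KV(2) by (simp add: card_Diff_subset finite_subset)
    then obtain d where "K - A = {d}" by (auto simp: card_1_singleton_iff)
    then have d: "K = insert d A" "d \<notin> A" using AK by auto
    have "w \<notin> A" "finite A" using core(1) AK KV(2) by (auto simp: finite_subset)
    then have wA: "clique G (insert w A)" "card (insert w A) = 4"
      using A core by (auto simp: clique_insert triangles_iff_clique N_def)
    have nwd: "{w, d} \<notin> edge_set G" using core(2,4) d AK by (auto simp: N_def)
    have "2 \<le> card (T \<inter> A)" if T: "T \<in> triangles G" for T
    proof (rule ccontr)
      assume small: "\<not> ?thesis"
      have "2 \<le> card (T \<inter> insert x A)" if "x = d \<or> x = w" for x
        using clique_meets_triangle[OF K(1) T] clique_meets_triangle[OF wA(1) T] K(2) wA(2) d(1) that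
        by auto
      then have "x \<in> T" if "x = d \<or> x = w" for x
        using small that by (metis Int_insert_right_if0)
      moreover have "w \<noteq> d" using core(1) d by auto
      ultimately have "{w, d} \<in> edge_set G" using triangle_edge[OF T] by simp
      with nwd show False by simp
    qed
    with A show ?thesis by blast
  next
    case pages
    have "triangles G \<subseteq> {T. T \<subseteq> K \<and> card T = 3} \<union> (\<lambda>w. insert w (N w)) ` (?V - K)"
    proof
      fix T assume T: "T \<in> triangles G"
      show "T \<in> {T. T \<subseteq> K \<and> card T = 3} \<union> (\<lambda>w. insert w (N w)) ` (?V - K)"
      proof (cases "T \<subseteq> K")
        case True
        then show ?thesis using triangle_card[OF T] by simp
      next
        case False
        then obtain w where w: "w \<in> T" "w \<notin> K" by auto
        have two: "2 \<le> card (T \<inter> K)" using clique_meets_triangle[OF K(1) T] K(2) by simp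
        have "insert w (T \<inter> K) = T"
          using two w triangle_finite[OF T] triangle_card[OF T]
          by (intro card_seteq) auto
        moreover have "T \<inter> K = N w"
        proof (rule card_seteq[OF fN])
          show "T \<inter> K \<subseteq> N w" using w triangle_edge[OF T] by (auto simp: N_def)
          show "card (N w) \<le> card (T \<inter> K)"
            using two pages w triangle_subset[OF T] by (meson DiffI order_trans subsetD)
        qed
        ultimately show ?thesis using w triangle_subset[OF T] by (intro UnI2 image_eqI[of _ _ w]) auto
      qed
    qed
    then have "card (triangles G) \<le> card ({T. T \<subseteq> K \<and> card T = 3} \<union> (\<lambda>w. insert w (N w)) ` (?V - K))"
      using fin KV(2) by (intro card_mono) auto
    also have "\<dots> \<le> card {T. T \<subseteq> K \<and> card T = 3} + card ((\<lambda>w. insert w (N w)) ` (?V - K))"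
      by (rule card_Un_le)
    also have "card {T. T \<subseteq> K \<and> card T = 3} = 4"
      using n_subsets[OF KV(2), of 3] K(2) by (simp add: numeral_eq_Suc)
    also have "card ((\<lambda>w. insert w (N w)) ` (?V - K)) \<le> card ?V - 4"
      using card_image_le[of "?V - K"] fin KV K(2) by (metis card_Diff_subset finite_Diff)
    also have "4 + (card ?V - 4) = card ?V" using card_mono[OF fin KV(1)] K(2) by simp
    finally show ?thesis by simp
  qed
qed

text \<open>First, some two triangles \<open>a b c\<close> and \<open>a d e\<close> share exactly one vertex, since triangles that pairwise share
  two vertices have a common vertex or span a four-clique. A third triangle avoiding \<open>a\<close> must be of
  the form \<open>b d f\<close>, up to renaming, so \<open>a b d\<close> is a triangle with a further triangle on each of its sides.
  A triangle meeting \<open>a b d\<close> in one vertex only has to meet the triangle on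
  the opposite side in its outer vertex, and this edge completes a four-clique.\<close>

lemma structure_without_K4:
  assumes noK4: "\<And>K. clique G K \<Longrightarrow> card K \<noteq> 4"
    and no_star: "\<And>v. v \<in> vertex_set G \<Longrightarrow> \<exists>T\<in>triangles G. v \<notin> T"
    and ne: "triangles G \<noteq> {}"
  shows "\<exists>A\<in>triangles G. \<forall>T\<in>triangles G. 2 \<le> card (T \<inter> A)"
proof -
  have K4: False if "T \<in> triangles G" "w \<in> vertex_set G" "w \<notin> T"
    "\<And>k. k \<in> T \<Longrightarrow> {w, k} \<in> edge_set G" for T w
    using noK4[of "insert w T"] that triangle_finite[OF that(1)]
    by (auto simp: clique_insert triangles_iff_clique)
  have "\<exists>T\<in>triangles G. \<exists>T'\<in>triangles G. card (T \<inter> T') = 1"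
  proof (rule ccontr)
    assume "\<not> ?thesis"
    then have none: "card (T \<inter> T') \<noteq> 1" if "T \<in> triangles G" "T' \<in> triangles G" for T T'
      using that by blast
    have two: "2 \<le> card (T \<inter> T')" if "T \<in> triangles G" "T' \<in> triangles G" for T T'
    proof -
      have "card (T \<inter> T') \<noteq> 0" using meet[OF that] triangle_finite[OF that(1)] by simp
      with none[OF that] show ?thesis by linarith
    qed
    have both: "u \<in> T \<and> v \<in> T" if "T \<in> triangles G" "T' \<in> triangles G" "T \<inter> T' \<subseteq> {u, v}" for T T' u v
    proof -
      have "T \<inter> T' = {u, v}"
        using two[OF that(1,2)] that(3) card_insert_le_m1[of 2 "{v}" u]
        by (intro card_seteq) (auto simp: card_insert_if)
      then show ?thesis by auto
    qed
    obtain T where T: "T \<in> triangles G" using ne by auto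
    then obtain a b c where abc: "T = {a, b, c}" "a \<noteq> b" "a \<noteq> c" "b \<noteq> c"
      using triangle_card[OF T] unfolding card_3_iff by blast
    have V: "a \<in> vertex_set G" "b \<in> vertex_set G" using triangle_subset[OF T] abc by auto
    obtain T' where T': "T' \<in> triangles G" "a \<notin> T'" using no_star V by blast
    have bc: "b \<in> T'" "c \<in> T'" using both[OF T'(1) T, of b c] T'(2) abc(1) by blast+
    obtain d where d: "T' = {b, c, d}" "d \<noteq> b" "d \<noteq> c"
      using card_3_two_members[OF triangle_card[OF T'(1)] bc abc(4)] by blast
    obtain T'' where T'': "T'' \<in> triangles G" "b \<notin> T''" using no_star V by blast
    have "T'' \<inter> T \<subseteq> {a, c}" "T'' \<inter> T' \<subseteq> {c, d}"
      unfolding abc(1) d(1) using T''(2) by blast+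
    then have "a \<in> T''" "d \<in> T''"
      using both[OF T''(1) T, of a c] both[OF T''(1) T'(1), of c d] by simp_all
    moreover have "d \<noteq> a" using T' d by auto
    ultimately have da: "{d, a} \<in> edge_set G" using triangle_edge[OF T''(1)] by blast
    show False
    proof (rule K4[OF T, of d])
      show "d \<in> vertex_set G" using triangle_subset[OF T'(1)] d by auto
      show "d \<notin> T" using abc d T' by auto
      show "{d, k} \<in> edge_set G" if "k \<in> T" for k
        using that abc da triangle_edge[OF T'(1), of d k] d by auto
    qed
  qed
  then obtain T1 T2 where T12: "T1 \<in> triangles G" "T2 \<in> triangles G" "card (T1 \<inter> T2) = 1"
    by blast
  obtain a where a: "T1 \<inter> T2 = {a}" using T12(3) by (auto simp: card_1_singleton_iff)
  have "a \<in> vertex_set G" using a triangle_subset[OF T12(1)] by auto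
  then obtain T3 where T3: "T3 \<in> triangles G" "a \<notin> T3" using no_star by blast
  obtain b where b: "b \<in> T1" "b \<in> T3" using meet[OF T12(1) T3(1)] by auto
  obtain d where d: "d \<in> T2" "d \<in> T3" using meet[OF T12(2) T3(1)] by auto
  have ne3: "a \<noteq> b" "a \<noteq> d" "b \<noteq> d" using a b d T3 by auto
  obtain c where c: "T1 = {a, b, c}" "c \<noteq> a" "c \<noteq> b"
    using card_3_two_members[OF triangle_card[OF T12(1)] _ b(1) ne3(1)] a by blast
  obtain e where e: "T2 = {a, d, e}" "e \<noteq> a" "e \<noteq> d"
    using card_3_two_members[OF triangle_card[OF T12(2)] _ d(1) ne3(2)] a by blast
  obtain f where f: "T3 = {b, d, f}" "f \<noteq> b" "f \<noteq> d"
    using card_3_two_members[OF triangle_card[OF T3(1)] b(2) d(2) ne3(3)] by blast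
  have ab: "{a, b} \<in> edge_set G" using triangle_edge[OF T12(1)] c ne3 by auto
  have ad: "{a, d} \<in> edge_set G" using triangle_edge[OF T12(2)] e ne3 by auto
  have bd: "{b, d} \<in> edge_set G" using triangle_edge[OF T3(1)] f ne3 by auto
  have V: "T1 \<subseteq> vertex_set G" "T2 \<subseteq> vertex_set G" "T3 \<subseteq> vertex_set G"
    using triangle_subset T12 T3 by auto
  have core: "{a, b, d} \<in> triangles G"
    using ab ad bd ne3 V c e by (auto simp: triangles_iff_clique clique_def insert_commute)
  have "2 \<le> card (T \<inter> {a, b, d})" if T: "T \<in> triangles G" for T
  proof (rule ccontr)
    assume small: "\<not> ?thesis"
    have pair: False if "u \<in> T" "v \<in> T" "u \<in> {a, b, d}" "v \<in> {a, b, d}" "u \<noteq> v" for u v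
      using card_mono[of "T \<inter> {a, b, d}" "{u, v}"] that small by simp
    obtain u where u: "u \<in> T" "u \<in> {a, b, d}" using meet[OF T core] by auto
    from u(2) consider "u = a" | "u = b" | "u = d" by auto
    then show False
    proof cases
      case 1
      have "f \<in> T" using meet[OF T T3(1)] pair u 1 ne3 f by blast
      moreover have "f \<noteq> a" using T3 f by auto
      ultimately have "{f, a} \<in> edge_set G" using triangle_edge[OF T] u 1 by auto
      moreover have "{f, b} \<in> edge_set G" "{f, d} \<in> edge_set G" using triangle_edge[OF T3(1)] f by auto
      ultimately show False using K4[OF core, of f] f \<open>f \<noteq> a\<close> V by auto
    next
      case 2
      have "e \<in> T" using meet[OF T T12(2)] pair u 2 ne3 e by blast
      moreover have "e \<noteq> b" using a c e by auto
      ultimately have "{e, b} \<in> edge_set G" using triangle_edge[OF T] u 2 by auto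
      moreover have "{e, a} \<in> edge_set G" "{e, d} \<in> edge_set G" using triangle_edge[OF T12(2)] e by auto
      ultimately show False using K4[OF core, of e] e \<open>e \<noteq> b\<close> V by auto
    next
      case 3
      have "c \<in> T" using meet[OF T T12(1)] pair u 3 ne3 c by blast
      moreover have "c \<noteq> d" using a c e by auto
      ultimately have "{c, d} \<in> edge_set G" using triangle_edge[OF T] u 3 by auto
      moreover have "{c, a} \<in> edge_set G" "{c, b} \<in> edge_set G" using triangle_edge[OF T12(1)] c by auto
      ultimately show False using K4[OF core, of c] c \<open>c \<noteq> d\<close> V by auto
    qed
  qed
  with core show ?thesis by blast
qed

text \<open>The four possible shapes of an intersecting triangle family that comes from a graph.\<close>

theorem triangle_structure:
  assumes "vertex_set G \<noteq> {}"
  obtains (star) v where "v \<in> vertex_set G" "\<And>T. T \<in> triangles G \<Longrightarrow> v \<in> T"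
    | (core) A where "A \<in> triangles G" "\<And>T. T \<in> triangles G \<Longrightarrow> 2 \<le> card (T \<inter> A)"
    | (K5) Q where "clique G Q" "card Q = 5" "\<And>T. T \<in> triangles G \<Longrightarrow> T \<subseteq> Q"
    | (few) "card (triangles G) \<le> card (vertex_set G)"
proof (cases "\<exists>K. clique G K \<and> card K = 4")
  case True
  then show ?thesis using structure_with_K4 core K5 few by metis
next
  case False
  show ?thesis
  proof (cases "\<exists>v\<in>vertex_set G. \<forall>T\<in>triangles G. v \<in> T")
    case True
    then show ?thesis using star by auto
  next
    case no: False
    then have "triangles G \<noteq> {}" using assms by auto
    with structure_without_K4 False no core show ?thesis by metis
  qed
qed

end

section \<open>Cliques and triangle cores\<close>

text \<open>All extremal graphs have adjacency depending only on vertex classes; class sizes then determine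
  the graph. This replaces explicit bijections into the disjoint unions and products by counting.\<close>

lemma graph_iso_by_colouring:
  fixes G :: "'a sgraph" and H :: "'b sgraph" and c :: "'a \<Rightarrow> nat" and d :: "'b \<Rightarrow> nat"
  assumes fin: "finite (vertex_set G)" "finite (vertex_set H)"
    and sizes: "\<And>k. card {v \<in> vertex_set G. c v = k} = card {w \<in> vertex_set H. d w = k}"
    and G: "\<And>u v. u \<in> vertex_set G \<Longrightarrow> v \<in> vertex_set G \<Longrightarrow>
      {u, v} \<in> edge_set G \<longleftrightarrow> u \<noteq> v \<and> R (c u) (c v)"
    and H: "\<And>u v. u \<in> vertex_set H \<Longrightarrow> v \<in> vertex_set H \<Longrightarrow>
      {u, v} \<in> edge_set H \<longleftrightarrow> u \<noteq> v \<and> R (d u) (d v)"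
  shows "graph_iso G H"
proof -
  have "\<exists>f. bij_betw f {v \<in> vertex_set G. c v = k} {w \<in> vertex_set H. d w = k}" for k
    using fin sizes by (intro finite_same_card_bij) auto
  then obtain f where f: "\<And>k. bij_betw (f k) {v \<in> vertex_set G. c v = k} {w \<in> vertex_set H. d w = k}"
    by metis
  define g where "g v = f (c v) v" for v
  have g: "g v \<in> vertex_set H" "d (g v) = c v" if "v \<in> vertex_set G" for v
    using bij_betwE[OF f[of "c v"]] that by (auto simp: g_def)
  have inj: "inj_on g (vertex_set G)"
  proof (rule inj_onI)
    fix u v assume uv: "u \<in> vertex_set G" "v \<in> vertex_set G" "g u = g v"
    then have "c u = c v" using g(2) by metis
    then show "u = v"
      using uv bij_betw_imp_inj_on[OF f[of "c v"]] by (auto simp: g_def inj_on_def)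
  qed
  have "w \<in> g ` vertex_set G" if w: "w \<in> vertex_set H" for w
  proof -
    have "w \<in> f (d w) ` {v \<in> vertex_set G. c v = d w}"
      using bij_betw_imp_surj_on[OF f[of "d w"]] w by auto
    then obtain v where "v \<in> vertex_set G" "c v = d w" "w = f (d w) v" by auto
    then show ?thesis by (intro image_eqI[of _ _ v]) (auto simp: g_def)
  qed
  then have "bij_betw g (vertex_set G) (vertex_set H)"
    using inj g(1) by (auto simp: bij_betw_def)
  moreover have "{u, v} \<in> edge_set G \<longleftrightarrow> {g u, g v} \<in> edge_set H"
    if "u \<in> vertex_set G" "v \<in> vertex_set G" for u v
    using G[OF that] H[OF g(1)[OF that(1)] g(1)[OF that(2)]] g(2)[OF that(1)] g(2)[OF that(2)]
      inj_on_eq_iff[OF inj that] by simp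
  ultimately show ?thesis unfolding graph_iso_def by blast
qed

lemma card_triples_containing:
  assumes "finite Q" "v \<in> Q"
  shows "card {T. T \<subseteq> Q \<and> card T = 3 \<and> v \<in> T} = (card Q - 1) choose 2"
proof -
  have "{T. T \<subseteq> Q \<and> card T = 3 \<and> v \<in> T} = insert v ` {S. S \<subseteq> Q - {v} \<and> card S = 2}"
  proof (intro equalityI subsetI)
    fix T assume "T \<in> {T. T \<subseteq> Q \<and> card T = 3 \<and> v \<in> T}"
    then show "T \<in> insert v ` {S. S \<subseteq> Q - {v} \<and> card S = 2}"
      by (intro image_eqI[of _ _ "T - {v}"]) (auto simp: card_Diff_singleton)
  next
    fix T assume "T \<in> insert v ` {S. S \<subseteq> Q - {v} \<and> card S = 2}"
    then obtain S where S: "T = insert v S" "S \<subseteq> Q - {v}" "card S = 2" by auto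
    moreover have "finite S" using S(2) assms(1) by (meson finite_Diff finite_subset)
    ultimately show "T \<in> {T. T \<subseteq> Q \<and> card T = 3 \<and> v \<in> T}"
      using assms by (auto simp: card_insert_if)
  qed
  moreover have "inj_on (insert v) {S. S \<subseteq> Q - {v} \<and> card S = 2}"
    by (rule inj_onI) blast
  ultimately show ?thesis
    using assms by (simp add: card_image n_subsets)
qed

text \<open>The constant vector serves for all triples inside a set \<open>Q\<close>.\<close>

lemma perron_certificate_clique:
  assumes "finite (vertex_set G)" "vertex_set G \<noteq> {}" "Q \<subseteq> vertex_set G"
    and "\<And>T. T \<in> triangles G \<Longrightarrow> T \<subseteq> Q"
  shows "perron_certificate G {T. T \<subseteq> Q \<and> card T = 3} (\<lambda>_. 1) (real ((card Q - 1) choose 2))"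
proof
  fix v assume "v \<in> vertex_set G"
  have fQ: "finite Q" using assms finite_subset by blast
  have "(\<Sum>T | T \<in> {T. T \<subseteq> Q \<and> card T = 3} \<and> v \<in> T. \<Prod>u\<in>T - {v}. 1 :: real)
      = real (card {T. T \<subseteq> Q \<and> card T = 3 \<and> v \<in> T})" by (simp add: conj_assoc)
  also have "\<dots> \<le> real ((card Q - 1) choose 2)"
  proof (cases "v \<in> Q")
    case True
    then show ?thesis using card_triples_containing[OF fQ] by simp
  next
    case False
    then have none: "{T. T \<subseteq> Q \<and> card T = 3 \<and> v \<in> T} = {}" by auto
    show ?thesis unfolding none by simp
  qed
  finally show "(\<Sum>T | T \<in> {T. T \<subseteq> Q \<and> card T = 3} \<and> v \<in> T. \<Prod>u\<in>T - {v}. 1)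
      \<le> real ((card Q - 1) choose 2) * 1\<^sup>2" by simp
qed (use assms triangle_card in auto)

lemma mu3_complete:
  assumes "0 < n"
  shows "mu3 (complete_graph n) = real ((n - 1) choose 2)"
proof (rule mu3_eq_certificate)
  let ?G = "complete_graph n"
  have V: "vertex_set ?G = {..<n}" by (simp add: complete_graph_def)
  have tri: "triangles ?G = {T. T \<subseteq> {..<n} \<and> card T = 3}"
    by (auto simp: triangles_def is_3clique_def complete_graph_def subset_iff)
  show "perron_certificate ?G (triangles ?G) (\<lambda>_. 1) (real ((n - 1) choose 2))"
    using perron_certificate_clique[of ?G "{..<n}"] assms unfolding V tri by auto
  fix v assume "v \<in> vertex_set ?G"
  then show "link_sum ?G v (\<lambda>_. 1) = real ((n - 1) choose 2) * 1\<^sup>2"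
    using card_triples_containing[of "{..<n}" v] by (simp add: link_sum_def tri V conj_assoc)
qed

lemma complete_if_all_triples:
  assumes "triangles G = {T. T \<subseteq> vertex_set G \<and> card T = 3}" "3 \<le> card (vertex_set G)"
    and "u \<in> vertex_set G" "v \<in> vertex_set G" "u \<noteq> v"
  shows "{u, v} \<in> edge_set G"
proof -
  have "\<not> vertex_set G \<subseteq> {u, v}" using assms(2) card_mono[of "{u, v}" "vertex_set G"] assms(5) by auto
  then obtain w where "w \<in> vertex_set G" "w \<noteq> u" "w \<noteq> v" by auto
  then have "{u, v, w} \<in> triangles G" using assms by simp
  then show ?thesis by (rule triangle_edge) (use assms in auto)
qed

lemma mu3_le_complete:
  assumes V: "finite (vertex_set G)" "card (vertex_set G) = n" "3 \<le> n"
  shows "mu3 G \<le> real ((n - 1) choose 2)"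
    and "mu3 G = real ((n - 1) choose 2) \<Longrightarrow> u \<in> vertex_set G \<Longrightarrow> v \<in> vertex_set G \<Longrightarrow>
      u \<noteq> v \<Longrightarrow> {u, v} \<in> edge_set G"
proof -
  let ?F = "{T. T \<subseteq> vertex_set G \<and> card T = 3}"
  have ne: "vertex_set G \<noteq> {}" using V by auto
  interpret perron_certificate G ?F "\<lambda>_. 1" "real ((n - 1) choose 2)"
    unfolding V(2)[symmetric]
    by (rule perron_certificate_clique) (use V(1) ne triangle_subset in auto)
  show "mu3 G \<le> real ((n - 1) choose 2)" by (rule mu3_le_certificate)
  assume eq: "mu3 G = real ((n - 1) choose 2)" and uv: "u \<in> vertex_set G" "v \<in> vertex_set G" "u \<noteq> v"
  have "triangles G = ?F"
  proof (rule triangles_eq_if_mu3_eq[OF _ eq])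
    fix S assume S: "S \<subseteq> vertex_set G" "S \<noteq> {}"
      and closed: "\<And>T. T \<in> ?F \<Longrightarrow> T \<inter> S = {} \<or> T \<subseteq> S"
    obtain s where s: "s \<in> S" using S(2) by auto
    show "S = vertex_set G"
    proof (rule ccontr)
      assume "S \<noteq> vertex_set G"
      then obtain w where w: "w \<in> vertex_set G" "w \<notin> S" using S(1) by auto
      have "card {s, w} \<le> 2" by (simp add: card_insert_if)
      then have "\<not> vertex_set G \<subseteq> {s, w}" using V card_mono[of "{s, w}" "vertex_set G"] by auto
      then obtain x where "x \<in> vertex_set G" "x \<noteq> s" "x \<noteq> w" by auto
      moreover have "s \<noteq> w" using w s by auto
      ultimately have "{s, w, x} \<in> ?F" using w s S(1) by auto
      with closed[of "{s, w, x}"] w s show False by blast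
    qed
  qed
  from complete_if_all_triples[OF this] uv V show "{u, v} \<in> edge_set G" by simp
qed

text \<open>The triangles of \<open>K\<^sub>3 \<or> (n - 3) K\<^sub>1\<close> with \<open>A\<close> as the three dominating vertices.\<close>

definition core_triples :: "'a set \<Rightarrow> 'a set \<Rightarrow> 'a set set" where
  "core_triples V A = {T. T \<subseteq> V \<and> card T = 3 \<and> 2 \<le> card (T \<inter> A)}"

lemma core_triples_at_core:
  assumes V: "A \<subseteq> V" "A = {a, b, c}" "a \<noteq> b" "a \<noteq> c" "b \<noteq> c"
  shows "{T. T \<in> core_triples V A \<and> a \<in> T}
    = insert A ((\<lambda>w. {a, b, w}) ` (V - A) \<union> (\<lambda>w. {a, c, w}) ` (V - A))"
proof (intro equalityI subsetI)
  fix T assume "T \<in> {T. T \<in> core_triples V A \<and> a \<in> T}"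
  then have T: "T \<subseteq> V" "card T = 3" "2 \<le> card (T \<inter> A)" "a \<in> T" by (auto simp: core_triples_def)
  obtain p q where pq: "T = {a, p, q}" "a \<noteq> p" "a \<noteq> q" "p \<noteq> q"
    using card_3_iff_member[OF T(2,4)] by blast
  have "p \<in> A \<or> q \<in> A"
  proof (rule ccontr)
    assume "\<not> ?thesis"
    then have "T \<inter> A = {a}" using pq V by auto
    with T(3) show False by simp
  qed
  then show "T \<in> insert A ((\<lambda>w. {a, b, w}) ` (V - A) \<union> (\<lambda>w. {a, c, w}) ` (V - A))"
    using pq T(1) V by (cases "p \<in> A"; cases "q \<in> A") (auto simp: insert_commute)
next
  fix T assume "T \<in> insert A ((\<lambda>w. {a, b, w}) ` (V - A) \<union> (\<lambda>w. {a, c, w}) ` (V - A))"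
  then consider "T = A" | w where "T = {a, b, w}" "w \<in> V - A" | w where "T = {a, c, w}" "w \<in> V - A"
    by auto
  then show "T \<in> {T. T \<in> core_triples V A \<and> a \<in> T}"
  proof cases
    case 1
    then show ?thesis using V by (auto simp: core_triples_def)
  next
    case 2
    then have "T \<inter> A = {a, b}" using V by auto
    then show ?thesis using 2 V by (auto simp: core_triples_def)
  next
    case 3
    then have "T \<inter> A = {a, c}" using V by auto
    then show ?thesis using 3 V by (auto simp: core_triples_def)
  qed
qed

lemma core_triples_off_core:
  assumes V: "A \<subseteq> V" "A = {a, b, c}" "a \<noteq> b" "a \<noteq> c" "b \<noteq> c" and w: "w \<in> V" "w \<notin> A"
  shows "{T. T \<in> core_triples V A \<and> w \<in> T} = {{w, a, b}, {w, a, c}, {w, b, c}}"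
proof (intro equalityI subsetI)
  fix T assume "T \<in> {T. T \<in> core_triples V A \<and> w \<in> T}"
  then have T: "T \<subseteq> V" "card T = 3" "2 \<le> card (T \<inter> A)" "w \<in> T" by (auto simp: core_triples_def)
  obtain p q where pq: "T = {w, p, q}" "w \<noteq> p" "w \<noteq> q" "p \<noteq> q"
    using card_3_iff_member[OF T(2,4)] by blast
  have "T \<inter> A = {p, q}"
    using T(3) pq w by (intro card_seteq) auto
  then have "p \<in> A" "q \<in> A" by auto
  then show "T \<in> {{w, a, b}, {w, a, c}, {w, b, c}}" using pq V by (auto simp: insert_commute)
next
  fix T assume T: "T \<in> {{w, a, b}, {w, a, c}, {w, b, c}}"
  then obtain p q where pq: "T = {w, p, q}" "p \<in> A" "q \<in> A" "p \<noteq> q" using V by auto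
  then have "T \<inter> A = {p, q}" "w \<noteq> p" "w \<noteq> q" using w by auto
  then show "T \<in> {T. T \<in> core_triples V A \<and> w \<in> T}" using pq w V(1) by (auto simp: core_triples_def)
qed

text \<open>The eigenvalue equation of \<open>K\<^sub>3 \<or> (n - 3) K\<^sub>1\<close> for the vector that is 1 on the core and \<open>\<theta>\<close> elsewhere.\<close>

lemma core_row_sums:
  fixes \<theta> :: real
  assumes V: "finite V" "A \<subseteq> V" "card A = 3" and v: "v \<in> V"
  defines "r \<equiv> \<lambda>v. if v \<in> A then 1 else \<theta>"
  shows "(\<Sum>T | T \<in> core_triples V A \<and> v \<in> T. \<Prod>u\<in>T - {v}. r u)
    = (if v \<in> A then 1 + 2 * real (card V - 3) * \<theta> else 3)"
proof (cases "v \<in> A")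
  case True
  obtain b c where A: "A = {v, b, c}" "v \<noteq> b" "v \<noteq> c" "b \<noteq> c"
    using card_3_iff_member[OF V(3) True] by blast
  let ?B = "(\<lambda>w. {v, b, w}) ` (V - A)" and ?C = "(\<lambda>w. {v, c, w}) ` (V - A)"
  have fin: "finite ?B" "finite ?C" using V(1) by auto
  have dis: "A \<notin> ?B \<union> ?C" "?B \<inter> ?C = {}"
  proof -
    show "A \<notin> ?B \<union> ?C" by blast
    have "{v, b, w} \<noteq> {v, c, w'}" if "w \<in> V - A" for w w'
    proof
      assume "{v, b, w} = {v, c, w'}"
      then have "c \<in> {v, b, w}" by simp
      moreover have "c \<in> A" using A(1) by simp
      ultimately show False using A(3,4) that by blast
    qed
    then show "?B \<inter> ?C = {}" by blast
  qed
  have page: "(\<Sum>T\<in>(\<lambda>w. {v, p, w}) ` (V - A). \<Prod>u\<in>T - {v}. r u) = (\<Sum>w\<in>V - A. \<theta>)"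
    if p: "p \<in> A" "p \<noteq> v" for p
  proof -
    have "inj_on (\<lambda>w. {v, p, w}) (V - A)"
    proof (rule inj_onI)
      fix x y assume x: "x \<in> V - A" and eq: "{v, p, x} = {v, p, y}"
      have "x \<in> {v, p, y}" unfolding eq[symmetric] by simp
      then show "x = y" using x p(1) True by auto
    qed
    moreover have "(\<Prod>u\<in>{v, p, w} - {v}. r u) = \<theta>" if w: "w \<in> V - A" for w
    proof -
      have "w \<noteq> v" "w \<noteq> p" using w p(1) True by blast+
      then have "{v, p, w} - {v} = {p, w}" "p \<noteq> w" using p(2) by blast+
      then show ?thesis using p(1) w by (simp add: r_def)
    qed
    ultimately show ?thesis by (simp add: sum.reindex)
  qed
  let ?f = "\<lambda>T. \<Prod>u\<in>T - {v}. r u"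
  have "(\<Sum>T\<in>insert A (?B \<union> ?C). ?f T) = ?f A + (\<Sum>T\<in>?B \<union> ?C. ?f T)"
    by (rule sum.insert[OF finite_UnI[OF fin] dis(1)])
  also have "(\<Sum>T\<in>?B \<union> ?C. ?f T) = (\<Sum>T\<in>?B. ?f T) + (\<Sum>T\<in>?C. ?f T)"
    by (rule sum.union_disjoint[OF fin dis(2)])
  also have "(\<Sum>T\<in>?B. ?f T) = (\<Sum>w\<in>V - A. \<theta>)" using A(2) by (intro page) (simp_all add: A(1))
  also have "(\<Sum>T\<in>?C. ?f T) = (\<Sum>w\<in>V - A. \<theta>)" using A(3) by (intro page) (simp_all add: A(1))
  also have "?f A = 1" by (intro prod.neutral) (auto simp: r_def)
  also have "(\<Sum>w\<in>V - A. \<theta>) = real (card V - 3) * \<theta>"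
    using V by (simp add: card_Diff_subset finite_subset)
  finally show ?thesis
    using True by (simp add: core_triples_at_core[OF V(2) A])
next
  case False
  obtain a b c where A: "A = {a, b, c}" "a \<noteq> b" "a \<noteq> c" "b \<noteq> c"
    using V(3) unfolding card_3_iff by blast
  have one: "(\<Prod>u\<in>{v, p, q} - {v}. r u) = 1" if "p \<in> A" "q \<in> A" for p q
    using that False by (intro prod.neutral) (auto simp: r_def)
  have "distinct [{v, a, b}, {v, a, c}, {v, b, c}]" using A False by (auto simp: insert_eq_iff doubleton_eq_iff)
  then show ?thesis
    unfolding core_triples_off_core[OF V(2) A v False] using False A one[of a b] one[of a c] one[of b c]
    by simp
qed

section \<open>Coloured graphs and the core eigenvalue\<close>

text \<open>The two equations say that \<open>(1, \<theta>)\<close> solves the row equations of \<open>core_row_sums\<close> with eigenvalue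
  \<open>l\<close>, where \<open>p = n - 3\<close> is the number of vertices off the core.\<close>

lemma core_parameters:
  fixes p :: nat
  obtains \<theta> l :: real where "0 < \<theta>" "l = 1 + 2 * real p * \<theta>" "l * \<theta>\<^sup>2 = 3"
proof -
  let ?f = "\<lambda>t :: real. (1 + 2 * real p * t) * t\<^sup>2"
  have "\<exists>t\<ge>0. t \<le> 2 \<and> ?f t = 3"
    by (rule IVT') (auto intro!: continuous_intros)
  then obtain t where t: "0 \<le> t" "?f t = 3" by auto
  then have "t \<noteq> 0" by auto
  with t that[of t "1 + 2 * real p * t"] show ?thesis by simp
qed

lemma perron_certificate_core:
  fixes \<theta> l :: real
  assumes V: "finite (vertex_set G)" "A \<subseteq> vertex_set G" "card A = 3"
    and tri: "\<And>T. T \<in> triangles G \<Longrightarrow> 2 \<le> card (T \<inter> A)"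
    and par: "0 < \<theta>" "l = 1 + 2 * real (card (vertex_set G) - 3) * \<theta>" "l * \<theta>\<^sup>2 = 3"
  shows "perron_certificate G (core_triples (vertex_set G) A) (\<lambda>v. if v \<in> A then 1 else \<theta>) l"
proof
  show "vertex_set G \<noteq> {}" using V by auto
  show "triangles G \<subseteq> core_triples (vertex_set G) A"
    using tri triangle_subset triangle_card by (auto simp: core_triples_def)
  fix v assume "v \<in> vertex_set G"
  then show "(\<Sum>T | T \<in> core_triples (vertex_set G) A \<and> v \<in> T. \<Prod>u\<in>T - {v}. if u \<in> A then 1 else \<theta>)
      \<le> l * (if v \<in> A then 1 else \<theta>)\<^sup>2"
    using core_row_sums[OF V, of v \<theta>] par by simp
qed (use V par in \<open>auto simp: core_triples_def\<close>)

lemma core_triples_connected: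
  assumes A: "A \<subseteq> V" "card A = 3"
    and S: "S \<subseteq> V" "S \<noteq> {}" and closed: "\<And>T. T \<in> core_triples V A \<Longrightarrow> T \<inter> S = {} \<or> T \<subseteq> S"
  shows "S = V"
proof -
  obtain a b c where abc: "A = {a, b, c}" "a \<noteq> b" "a \<noteq> c" "b \<noteq> c"
    using A(2) unfolding card_3_iff by blast
  have page: "{w, a, b} \<in> core_triples V A" if "w \<in> V" "w \<notin> A" for w
    using core_triples_off_core[OF A(1) abc that] by blast
  have AF: "A \<in> core_triples V A" using A by (simp add: core_triples_def)
  obtain s where s: "s \<in> S" using S(2) by auto
  have "A \<inter> S \<noteq> {}"
  proof (cases "s \<in> A")
    case False
    then have "{s, a, b} \<subseteq> S" using closed[OF page] s S(1) by blast
    then show ?thesis using abc by auto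
  qed (use s in auto)
  then have AS: "A \<subseteq> S" using closed[OF AF] by auto
  have "w \<in> S" if "w \<in> V" for w
  proof (cases "w \<in> A")
    case False
    have "a \<in> S" using AS abc(1) by auto
    then show ?thesis using closed[OF page[OF that False]] by auto
  qed (use AS in auto)
  then show ?thesis using S(1) by auto
qed

text \<open>Eliminating \<open>\<theta>\<close> leaves a cubic for the eigenvalue, whose left-hand side is increasing beyond 1; so
  comparing \<open>l\<close> with a number means evaluating the cubic there.\<close>

lemma core_cubic_equation:
  fixes \<theta> l :: real
  assumes "0 < \<theta>" "l = 1 + 2 * real p * \<theta>" "l * \<theta>\<^sup>2 = 3"
  shows "l * (l - 1)\<^sup>2 = 12 * (real p)\<^sup>2"
proof -
  have "l * (l - 1)\<^sup>2 = 4 * (real p)\<^sup>2 * (l * \<theta>\<^sup>2)"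
    unfolding assms(2) by (simp add: power_mult_distrib)
  then show ?thesis using assms(3) by simp
qed

lemma cubic_mono:
  fixes x y :: real
  assumes "1 \<le> x" "x \<le> y"
  shows "x * (x - 1)\<^sup>2 \<le> y * (y - 1)\<^sup>2"
  using assms by (intro mult_mono power_mono) auto

text \<open>Adjacency is the relation \<open>R\<close> on colours, and the colours 0, 1, 2 occur \<open>k0\<close>, \<open>k1\<close>, \<open>k2\<close>
  times; every other colour is absent. Three colours are enough for all extremal graphs.\<close>

definition coloured_graph ::
    "'a sgraph \<Rightarrow> ('a \<Rightarrow> nat) \<Rightarrow> (nat \<Rightarrow> nat \<Rightarrow> bool) \<Rightarrow> nat \<Rightarrow> nat \<Rightarrow> nat \<Rightarrow> bool" where
  "coloured_graph G c R k0 k1 k2 \<longleftrightarrow> finite (vertex_set G) \<and>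
     (\<forall>u\<in>vertex_set G. \<forall>v\<in>vertex_set G. {u, v} \<in> edge_set G \<longleftrightarrow> u \<noteq> v \<and> R (c u) (c v)) \<and>
     (\<forall>k. card {v \<in> vertex_set G. c v = k} =
        (if k = 0 then k0 else if k = 1 then k1 else if k = 2 then k2 else 0))"

lemma coloured_graph_unique:
  "coloured_graph G c R k0 k1 k2 \<Longrightarrow> coloured_graph H d R k0 k1 k2 \<Longrightarrow> graph_iso G H"
  unfolding coloured_graph_def by (rule graph_iso_by_colouring[where c = c and d = d and R = R]) auto

lemma coloured_graphD:
  assumes "coloured_graph G c R k0 k1 k2"
  shows "finite (vertex_set G)"
    and "\<And>u v. u \<in> vertex_set G \<Longrightarrow> v \<in> vertex_set G \<Longrightarrow> {u, v} \<in> edge_set G \<longleftrightarrow> u \<noteq> v \<and> R (c u) (c v)"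
    and "card {v \<in> vertex_set G. c v = 0} = k0" "card {v \<in> vertex_set G. c v = 1} = k1"
    and "card {v \<in> vertex_set G. c v = 2} = k2"
    and "\<And>v. v \<in> vertex_set G \<Longrightarrow> c v < 3"
proof -
  show "finite (vertex_set G)"
    and "\<And>u v. u \<in> vertex_set G \<Longrightarrow> v \<in> vertex_set G \<Longrightarrow> {u, v} \<in> edge_set G \<longleftrightarrow> u \<noteq> v \<and> R (c u) (c v)"
    and "card {v \<in> vertex_set G. c v = 0} = k0" "card {v \<in> vertex_set G. c v = 1} = k1"
    and "card {v \<in> vertex_set G. c v = 2} = k2"
    using assms by (simp_all add: coloured_graph_def)
  fix v assume v: "v \<in> vertex_set G"
  show "c v < 3"
  proof (rule ccontr)
    assume "\<not> c v < 3"
    then have "card {u \<in> vertex_set G. c u = c v} = 0" using assms by (simp add: coloured_graph_def)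
    then show False using v \<open>finite (vertex_set G)\<close> by auto
  qed
qed

lemma coloured_graphI:
  assumes "finite (vertex_set G)"
    and "\<And>u v. u \<in> vertex_set G \<Longrightarrow> v \<in> vertex_set G \<Longrightarrow> {u, v} \<in> edge_set G \<longleftrightarrow> u \<noteq> v \<and> R (c u) (c v)"
    and "card {v \<in> vertex_set G. c v = 0} = k0" "card {v \<in> vertex_set G. c v = 1} = k1"
    and "card {v \<in> vertex_set G. c v = 2} = k2"
    and "\<And>v. v \<in> vertex_set G \<Longrightarrow> c v < 3"
  shows "coloured_graph G c R k0 k1 k2"
proof -
  have "card {v \<in> vertex_set G. c v = k} =
      (if k = 0 then k0 else if k = 1 then k1 else if k = 2 then k2 else 0)" for k
  proof -
    consider "k = 0" | "k = 1" | "k = 2" | "3 \<le> k" by linarith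
    then show ?thesis
    proof cases
      case 4
      then have "{v \<in> vertex_set G. c v = k} = {}" using assms(6) by force
      then show ?thesis using 4 by (simp only: card.empty) simp
    qed (simp_all only: assms(3-5), simp_all)
  qed
  with assms(1,2) show ?thesis unfolding coloured_graph_def by blast
qed

lemma coloured_graph_partition:
  assumes "coloured_graph G c R k0 k1 k2"
  shows "vertex_set G = {v \<in> vertex_set G. c v = 0} \<union> {v \<in> vertex_set G. c v = 1} \<union> {v \<in> vertex_set G. c v = 2}"
proof -
  have "c v = 0 \<or> c v = 1 \<or> c v = 2" if "v \<in> vertex_set G" for v
    using coloured_graphD(6)[OF assms that] by linarith
  then show ?thesis by blast
qed

lemma coloured_graph_card:
  assumes "coloured_graph G c R k0 k1 k2"
  shows "card (vertex_set G) = k0 + k1 + k2"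
proof -
  note D = coloured_graphD[OF assms]
  let ?C = "\<lambda>k. {v \<in> vertex_set G. c v = k}"
  have "card (vertex_set G) = card (?C 0 \<union> ?C 1 \<union> ?C 2)"
    using coloured_graph_partition[OF assms] by simp
  also have "\<dots> = card (?C 0 \<union> ?C 1) + card (?C 2)"
    using D(1) by (intro card_Un_disjoint) auto
  also have "card (?C 0 \<union> ?C 1) = card (?C 0) + card (?C 1)"
    using D(1) by (intro card_Un_disjoint) auto
  finally show ?thesis using D(3-5) by simp
qed

abbreviation core_adj :: "nat \<Rightarrow> nat \<Rightarrow> bool" where
  "core_adj i j \<equiv> i = 0 \<or> j = 0"

lemma mu3_core_graph:
  assumes H: "coloured_graph H c core_adj 3 p 0"
    and par: "0 < \<theta>" "l = 1 + 2 * real p * \<theta>" "l * \<theta>\<^sup>2 = 3"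
  shows "mu3 H = l"
proof -
  note D = coloured_graphD[OF H]
  let ?V = "vertex_set H"
  let ?A = "{v \<in> ?V. c v = 0}"
  have A: "?A \<subseteq> ?V" "card ?A = 3" using D(3) by auto
  have card: "card ?V - 3 = p" using coloured_graph_card[OF H] by simp
  have tri: "triangles H = core_triples ?V ?A"
  proof (intro equalityI subsetI)
    fix T assume T: "T \<in> triangles H"
    have "card (T - ?A) \<le> 1"
    proof (rule ccontr)
      assume "\<not> ?thesis"
      then obtain S where S: "S \<subseteq> T - ?A" "card S = 2"
        using obtain_subset_with_card_n[of 2 "T - ?A"] by auto
      then obtain u v where "u \<in> T" "v \<in> T" "u \<noteq> v" "u \<notin> ?A" "v \<notin> ?A"
        by (auto simp: card_2_iff)
      moreover from this have "u \<in> ?V" "v \<in> ?V" using triangle_subset[OF T] by blast+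
      ultimately show False using triangle_edge[OF T, of u v] D(2)[of u v] by auto
    qed
    moreover have "card T = card (T \<inter> ?A) + card (T - ?A)"
      using card_Int_Diff[OF triangle_finite[OF T]] .
    ultimately have "2 \<le> card (T \<inter> ?A)" using triangle_card[OF T] by linarith
    then show "T \<in> core_triples ?V ?A"
      unfolding core_triples_def using triangle_subset[OF T] triangle_card[OF T] by blast
  next
    fix T assume "T \<in> core_triples ?V ?A"
    then have T: "T \<subseteq> ?V" "card T = 3" "2 \<le> card (T \<inter> ?A)" unfolding core_triples_def by blast+
    have fT: "finite T" using T(1) D(1) finite_subset by blast
    have "{u, v} \<in> edge_set H" if uv: "u \<in> T" "v \<in> T" "u \<noteq> v" for u v
    proof (rule ccontr)
      assume "{u, v} \<notin> edge_set H"
      then have "u \<notin> ?A" "v \<notin> ?A" using D(2)[of u v] uv T(1) by auto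
      then have "T \<inter> ?A \<subseteq> T - {u, v}" by auto
      then have "card (T \<inter> ?A) \<le> card (T - {u, v})" using fT by (intro card_mono) auto
      also have "\<dots> = 1" using uv T(2) fT by (simp add: card_Diff_subset)
      finally show False using T(3) by simp
    qed
    then show "T \<in> triangles H" using T by (auto simp: triangles_iff_clique clique_def)
  qed
  show ?thesis
  proof (rule mu3_eq_certificate)
    show "perron_certificate H (triangles H) (\<lambda>v. if v \<in> ?A then 1 else \<theta>) l"
      unfolding tri using perron_certificate_core[OF D(1) A, of \<theta> l] par tri card
      by (simp add: core_triples_def)
    fix v assume "v \<in> ?V"
    then show "link_sum H v (\<lambda>v. if v \<in> ?A then 1 else \<theta>) = l * (if v \<in> ?A then 1 else \<theta>)\<^sup>2"
      unfolding link_sum_def tri using core_row_sums[OF D(1) A, of v \<theta>] par card by simp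
  qed
qed

text \<open>In the case of equality every core triple is a triangle, which supplies all edges at \<open>A\<close>; and an edge
  off \<open>A\<close> would form a triangle with any single core vertex, contrary to the core condition.\<close>

lemma mu3_le_core:
  assumes simple: "simple_graph G" and V: "finite (vertex_set G)" "card (vertex_set G) = p + 3" "0 < p"
    and A: "A \<subseteq> vertex_set G" "card A = 3"
    and tri: "\<And>T. T \<in> triangles G \<Longrightarrow> 2 \<le> card (T \<inter> A)"
    and par: "0 < \<theta>" "l = 1 + 2 * real p * \<theta>" "l * \<theta>\<^sup>2 = 3"
  shows "mu3 G \<le> l" and "mu3 G = l \<Longrightarrow> \<exists>c. coloured_graph G c core_adj 3 p 0"
proof -
  let ?V = "vertex_set G"
  interpret perron_certificate G "core_triples ?V A" "\<lambda>v. if v \<in> A then 1 else \<theta>" l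
    by (rule perron_certificate_core) (use V A tri par in auto)
  show "mu3 G \<le> l" by (rule mu3_le_certificate)
  assume "mu3 G = l"
  then have F: "triangles G = core_triples ?V A"
    using triangles_eq_if_mu3_eq core_triples_connected[OF A] by metis
  have edge: "{u, v} \<in> edge_set G" if u: "u \<in> A" and v: "v \<in> ?V" "u \<noteq> v" for u v
  proof -
    obtain b c where abc: "A = {u, b, c}" "u \<noteq> b" "u \<noteq> c" "b \<noteq> c"
      using card_3_iff_member[OF A(2) u] by blast
    have "A \<in> triangles G" using A by (simp add: F core_triples_def)
    moreover have "{v, u, b} \<in> triangles G" if "v \<notin> A"
      using core_triples_off_core[OF A(1) abc v(1) that] F by blast
    ultimately show ?thesis using triangle_edge[of _ G u v] u v by blast
  qed
  have non_edge: "u \<in> A \<or> v \<in> A" if uv: "{u, v} \<in> edge_set G" "u \<in> ?V" "v \<in> ?V" "u \<noteq> v" for u v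
  proof (rule ccontr)
    assume off: "\<not> ?thesis"
    obtain a where a: "a \<in> A" using A(2) by fastforce
    have "{a, u, v} \<in> triangles G"
      using edge[OF a, of u] edge[OF a, of v] uv off a A(1)
      by (auto simp: triangles_iff_clique clique_def insert_commute card_insert_if)
    then have "2 \<le> card ({a, u, v} \<inter> A)" by (rule tri)
    moreover have "{a, u, v} \<inter> A = {a}" using a off by auto
    ultimately show False by simp
  qed
  have loop: "{u} \<notin> edge_set G" for u
    using simple by (auto simp: simple_graph_def)
  let ?c = "\<lambda>v. if v \<in> A then 0 else 1 :: nat"
  have "coloured_graph G ?c core_adj 3 p 0"
  proof (rule coloured_graphI)
    fix u v assume uv: "u \<in> ?V" "v \<in> ?V"
    show "{u, v} \<in> edge_set G \<longleftrightarrow> u \<noteq> v \<and> core_adj (?c u) (?c v)"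
    proof (cases "u = v")
      case True
      then show ?thesis using loop[of u] by simp
    next
      case False
      then show ?thesis
        using edge[of u v] edge[of v u] non_edge[of u v] uv by (auto simp: insert_commute)
    qed
  next
    have "{v \<in> ?V. ?c v = 0} = A" "{v \<in> ?V. ?c v = 1} = ?V - A" "{v \<in> ?V. ?c v = 2} = {}"
      using A(1) by auto
    moreover have "card (?V - A) = p" using A V by (simp add: card_Diff_subset finite_subset)
    ultimately show "card {v \<in> ?V. ?c v = 0} = 3" "card {v \<in> ?V. ?c v = 1} = p"
      "card {v \<in> ?V. ?c v = 2} = 0"
      using A(2) by simp_all
  qed (use V(1) in auto)
  then show "\<exists>c. coloured_graph G c core_adj 3 p 0" by (rule exI[of _ ?c])
qed

section \<open>Triangles through a common vertex\<close>

text \<open>All triangles share the vertex \<open>v\<close>. They correspond to the edges of the link of \<open>v\<close>,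
  a triangle-free graph on the remaining vertices.\<close>

locale triangle_star =
  fixes G :: "'a sgraph" and v :: 'a
  assumes fin: "finite (vertex_set G)" and v: "v \<in> vertex_set G"
    and star: "\<And>T. T \<in> triangles G \<Longrightarrow> v \<in> T"
begin

definition link_adj :: "'a \<Rightarrow> 'a \<Rightarrow> bool" where
  "link_adj i j \<longleftrightarrow> is_3clique G {v, i, j}"

abbreviation U :: "'a set" where
  "U \<equiv> vertex_set G - {v}"

lemma link_adj_iff: "link_adj i j \<longleftrightarrow> {v, i, j} \<in> triangles G"
  by (simp add: link_adj_def triangles_def)

lemma link_adj_sym: "link_adj i j \<Longrightarrow> link_adj j i"
  by (simp add: link_adj_def insert_commute)

lemma link_adj_distinct: "link_adj i j \<Longrightarrow> i \<noteq> v \<and> j \<noteq> v \<and> i \<noteq> j"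
proof -
  assume "link_adj i j"
  then have c: "card {v, i, j} = 3" by (simp add: link_adj_def is_3clique_def)
  show ?thesis
  proof (intro conjI notI)
    assume "i = v" with c show False by (simp add: card_insert_if split: if_splits)
  next
    assume "j = v" with c show False by (simp add: card_insert_if split: if_splits)
  next
    assume "i = j" with c show False by (simp add: card_insert_if split: if_splits)
  qed
qed

lemma link_adj_edge: "link_adj i j \<Longrightarrow> {i, j} \<in> edge_set G \<and> {v, i} \<in> edge_set G \<and> {v, j} \<in> edge_set G"
  using link_adj_distinct[of i j] by (auto simp: link_adj_iff intro!: triangle_edge[of "{v, i, j}"])

text \<open>A triangle in the link would be a triangle of \<open>G\<close> missing \<open>v\<close>.\<close>

lemma link_adj_triangle_free: "\<forall>i j k. link_adj i j \<longrightarrow> link_adj j k \<longrightarrow> \<not> link_adj i k"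
proof (intro allI impI notI)
  fix i j k assume adj: "link_adj i j" "link_adj j k" "link_adj i k"
  note distinct = link_adj_distinct[OF adj(1)] link_adj_distinct[OF adj(2)] link_adj_distinct[OF adj(3)]
  have "{i, j, k} \<in> triangles G"
    using adj link_adj_edge[OF adj(1)] link_adj_edge[OF adj(2)] link_adj_edge[OF adj(3)] distinct
      triangle_subset[of "{v, i, j}" G] triangle_subset[of "{v, j, k}" G]
    by (auto simp: link_adj_iff triangles_iff_clique clique_def insert_commute)
  from star[OF this] show False using distinct by auto
qed

lemma link_adj_mem: "link_adj i j \<Longrightarrow> i \<in> U \<and> j \<in> U"
  using link_adj_distinct[of i j] triangle_subset[of "{v, i, j}" G] by (auto simp: link_adj_iff)

lemma triangle_sum_star:
  "triangle_sum G z = z v * (\<Sum>i\<in>U. z i * (\<Sum>j | j \<in> U \<and> link_adj i j. z j)) / 2"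
  for z :: "'a \<Rightarrow> real"
proof -
  let ?V = "vertex_set G"
  have "triangle_sum G z = (\<Sum>T | T \<in> triangles G \<and> v \<in> T. z v * (\<Prod>u\<in>T - {v}. z u))"
    unfolding triangle_sum_def
  proof (rule sum.cong)
    fix T assume "T \<in> {T. T \<in> triangles G \<and> v \<in> T}"
    then show "(\<Prod>u\<in>T. z u) = z v * (\<Prod>u\<in>T - {v}. z u)"
      using prod.remove[of T v z] triangle_finite[of T G] by simp
  qed (use star in auto)
  also have "\<dots> = z v * link_sum G v z" by (simp add: link_sum_def sum_distrib_left)
  also have "link_sum G v z = (\<Sum>i\<in>?V. \<Sum>j\<in>?V. (if link_adj i j then 1 / 2 else 0) * z i * z j)"
    unfolding link_adj_def by (rule tensor_row_eq_link_sum[OF fin, symmetric])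
  also have "\<dots> = (\<Sum>i\<in>U. z i * (\<Sum>j | j \<in> U \<and> link_adj i j. z j) / 2)"
  proof (rule sum.mono_neutral_cong_right[OF fin])
    show "\<forall>i\<in>?V - U. (\<Sum>j\<in>?V. (if link_adj i j then 1 / 2 else 0) * z i * z j) = 0"
    proof
      fix i assume "i \<in> ?V - U"
      then have "\<not> link_adj i j" for j using link_adj_mem[of i j] by blast
      then show "(\<Sum>j\<in>?V. (if link_adj i j then 1 / 2 else 0) * z i * z j) = 0" by simp
    qed
    fix i
    have "(\<Sum>j\<in>?V. (if link_adj i j then 1 / 2 else 0) * z i * z j)
        = (\<Sum>j | j \<in> U \<and> link_adj i j. z i * z j / 2)"
    proof (rule sum.mono_neutral_cong_right[OF fin])
      show "\<forall>j\<in>?V - {j. j \<in> U \<and> link_adj i j}. (if link_adj i j then 1 / 2 else 0) * z i * z j = 0"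
      proof
        fix j assume "j \<in> ?V - {j. j \<in> U \<and> link_adj i j}"
        then have "\<not> link_adj i j" using link_adj_mem[of i j] by blast
        then show "(if link_adj i j then 1 / 2 else 0) * z i * z j = 0" by simp
      qed
    qed auto
    then show "(\<Sum>j\<in>?V. (if link_adj i j then 1 / 2 else 0) * z i * z j)
        = z i * (\<Sum>j | j \<in> U \<and> link_adj i j. z j) / 2"
      by (simp add: sum_distrib_left sum_divide_distrib)
  qed auto
  finally show ?thesis by (simp only: sum_divide_distrib[symmetric] times_divide_eq_right)
qed

text \<open>By weighted Mantel the Lagrangian is at most the maximum of \<open>a * (1 - a)\<^sup>2 / 4\<close>, that is
  \<open>1 / 27\<close>, the value for a complete tripartite system.\<close>

lemma mu3_cubed_le_star: "mu3 G ^ 3 \<le> (real (card (triangles G)))\<^sup>2"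
proof -
  have "mu3 G ^ 3 \<le> 27 * (1 / 27) * (real (card (triangles G)))\<^sup>2"
  proof (rule mu3_cubed_le[OF fin])
    show "vertex_set G \<noteq> {}" using v by auto
    fix z :: "'a \<Rightarrow> real"
    assume z: "\<And>u. u \<in> vertex_set G \<Longrightarrow> 0 \<le> z u" and z1: "(\<Sum>u\<in>vertex_set G. z u) = 1"
    have U1: "(\<Sum>i\<in>U. z i) = 1 - z v" using sum.remove[OF fin v, of z] z1 by simp
    have "(\<Sum>i\<in>U. z i * (\<Sum>j | j \<in> U \<and> link_adj i j. z j)) \<le> (1 - z v)\<^sup>2 / 2"
      unfolding U1[symmetric]
    proof (rule weighted_mantel)
      show "link_adj j i" if "link_adj i j" for i j using that by (rule link_adj_sym)
      show "\<forall>i j k. link_adj i j \<longrightarrow> link_adj j k \<longrightarrow> \<not> link_adj i k" by (rule link_adj_triangle_free)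
    qed (use fin z in auto)
    then have "triangle_sum G z \<le> z v * ((1 - z v)\<^sup>2 / 2) / 2"
      unfolding triangle_sum_star using z[OF v] by (intro divide_right_mono mult_left_mono) auto
    also have "\<dots> \<le> 1 / 27"
    proof -
      have zv: "z v \<le> 1" using U1 sum_nonneg[of U z] z by auto
      have "1 / 27 - z v * ((1 - z v)\<^sup>2 / 2) / 2 = (z v - 1 / 3)\<^sup>2 * (4 / 3 - z v) / 4"
        by (simp add: power2_eq_square field_simps)
      also have "\<dots> \<ge> 0" using zv by simp
      finally show ?thesis by simp
    qed
    finally show "triangle_sum G z \<le> 1 / 27" .
  qed
  then show ?thesis by simp
qed

lemma double_card_triangles: "2 * card (triangles G) = (\<Sum>i\<in>U. card {j \<in> U. link_adj i j})"
proof -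
  have "real (2 * card (triangles G)) = 2 * triangle_sum G (\<lambda>_. 1 :: real)"
    by (simp add: triangle_sum_def)
  also have "\<dots> = real (\<Sum>i\<in>U. card {j \<in> U. link_adj i j})"
    unfolding triangle_sum_star by simp
  finally show ?thesis by linarith
qed

lemma card_triangles_le: "card (triangles G) \<le> (card U)\<^sup>2 div 4"
proof -
  have "(\<Sum>i\<in>U. 1 * (\<Sum>j | j \<in> U \<and> link_adj i j. 1 :: real)) \<le> (\<Sum>i\<in>U. 1)\<^sup>2 / 2"
  proof (rule weighted_mantel)
    show "link_adj j i" if "link_adj i j" for i j using that by (rule link_adj_sym)
    show "\<forall>i j k. link_adj i j \<longrightarrow> link_adj j k \<longrightarrow> \<not> link_adj i k" by (rule link_adj_triangle_free)
  qed (use fin in auto)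
  then have "real (4 * card (triangles G)) \<le> real ((card U)\<^sup>2)"
    using double_card_triangles by (simp flip: of_nat_sum)
  then have "4 * card (triangles G) \<le> (card U)\<^sup>2" by linarith
  then show ?thesis by linarith
qed

end

text \<open>For \<open>x \<le> y\<close>, \<open>(x + y)\<^sup>2 - 4 * (x * y) = (y - x)\<^sup>2\<close> is at least 4 once \<open>y \<ge> x + 2\<close>.\<close>

lemma balanced_if_product_max:
  fixes a b m :: nat
  assumes "a + b = m" "a * b = m\<^sup>2 div 4"
  shows "a = m div 2 \<and> b = m - m div 2 \<or> b = m div 2 \<and> a = m - m div 2"
proof -
  have aux: "y \<le> x + 1" if xy: "x \<le> y" "x + y = m" "x * y = m\<^sup>2 div 4" for x y
  proof (rule ccontr)
    assume "\<not> ?thesis"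
    then have k: "y = x + 2 + (y - x - 2)" by linarith
    define k where "k = y - x - 2"
    note k = k[folded k_def]
    have "m\<^sup>2 < 4 * (x * y) + 4" using xy(3) by simp
    moreover have "m\<^sup>2 = 4 * (x * y) + (2 + k)\<^sup>2"
      unfolding xy(2)[symmetric] k by (simp add: power2_eq_square algebra_simps)
    ultimately show False by (simp add: power2_eq_square)
  qed
  show ?thesis
    using aux[of a b] aux[of b a] assms by (cases "a \<le> b") (auto simp: mult.commute)
qed

text \<open>The link has the maximal number of edges allowed by Mantel's theorem, so it is a balanced complete
  bipartite graph. Both parts are nonempty, so every vertex lies on a link edge and is
  therefore adjacent to \<open>v\<close>; after that the edges of \<open>G\<close> among the remaining vertices are precisely the link edges.\<close>

lemma (in triangle_star) coloured_if_extremal: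
  assumes simple: "simple_graph G" and m: "card (vertex_set G) = m + 1" "2 \<le> m"
    and many: "m\<^sup>2 div 4 \<le> card (triangles G)"
  shows "\<exists>c. coloured_graph G c (\<noteq>) 1 (m div 2) (m - m div 2)"
proof -
  let ?V = "vertex_set G"
  have cU: "card U = m" using m v fin by simp
  have fU: "finite U" using fin by simp
  have "2 * ((card U)\<^sup>2 div 4) \<le> (\<Sum>i\<in>U. card {j \<in> U. link_adj i j})"
    using many cU double_card_triangles by simp
  moreover have "\<forall>i j. link_adj i j \<longrightarrow> link_adj j i" using link_adj_sym by blast
  ultimately
  obtain N C where NC: "N \<union> C = U" "N \<inter> C = {}" "card N * card C = (card U)\<^sup>2 div 4"
    and adj_NC: "\<And>i j. i \<in> U \<Longrightarrow> j \<in> U \<Longrightarrow> link_adj i j \<longleftrightarrow> (i \<in> N) \<noteq> (j \<in> N)"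
    using mantel_equality[of U link_adj, OF fU _ link_adj_triangle_free] by blast
  have fNC: "finite N" "finite C" using NC(1) fU by (metis finite_Un)+
  have sumNC: "card N + card C = m" using card_Un_disjoint[OF fNC NC(2)] NC(1) cU by simp
  have bal: "card N = m div 2 \<and> card C = m - m div 2 \<or> card C = m div 2 \<and> card N = m - m div 2"
    using balanced_if_product_max[OF sumNC] NC(3) cU by simp
  then obtain A B where AB: "A \<union> B = U" "A \<inter> B = {}" "card A = m div 2" "card B = m - m div 2"
    and adj_AB: "\<And>i j. i \<in> U \<Longrightarrow> j \<in> U \<Longrightarrow> link_adj i j \<longleftrightarrow> (i \<in> A) \<noteq> (j \<in> A)"
  proof (elim disjE)
    assume "card N = m div 2 \<and> card C = m - m div 2"
    then show thesis using that[of N C] NC adj_NC by blast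
  next
    assume *: "card C = m div 2 \<and> card N = m - m div 2"
    have "link_adj i j \<longleftrightarrow> (i \<in> C) \<noteq> (j \<in> C)" if "i \<in> U" "j \<in> U" for i j
      using adj_NC[OF that] that NC(1,2) by blast
    moreover have "C \<union> N = U" "C \<inter> N = {}" using NC(1,2) by blast+
    ultimately show thesis using that[of C N] * by blast
  qed
  have "A \<noteq> {}" "B \<noteq> {}" using AB(3,4) m(2) by auto
  then have spoke: "{v, i} \<in> edge_set G" if i: "i \<in> U" for i
  proof -
    obtain j where "j \<in> U" "(i \<in> A) \<noteq> (j \<in> A)"
      using \<open>A \<noteq> {}\<close> \<open>B \<noteq> {}\<close> AB(1,2) by blast
    then have "link_adj i j" using adj_AB i by blast
    then show ?thesis using link_adj_edge by blast
  qed
  have loop: "{u} \<notin> edge_set G" for u using simple by (auto simp: simple_graph_def)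
  have edge_iff: "{i, j} \<in> edge_set G \<longleftrightarrow> link_adj i j" if ij: "i \<in> U" "j \<in> U" for i j
  proof
    assume e: "{i, j} \<in> edge_set G"
    then have "i \<noteq> j" using loop[of i] by auto
    then show "link_adj i j"
      using e ij spoke[OF ij(1)] spoke[OF ij(2)] v
      by (auto simp: link_adj_iff triangles_iff_clique clique_def insert_commute card_insert_if)
  qed (use link_adj_edge in blast)
  let ?c = "\<lambda>u. if u = v then 0 else if u \<in> A then 1 else 2 :: nat"
  have vAB: "v \<notin> A" "v \<notin> B" using AB(1) by blast+
  have "coloured_graph G ?c (\<noteq>) 1 (m div 2) (m - m div 2)"
  proof (rule coloured_graphI)
    fix i j assume ij: "i \<in> ?V" "j \<in> ?V"
    show "{i, j} \<in> edge_set G \<longleftrightarrow> i \<noteq> j \<and> ?c i \<noteq> ?c j"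
    proof (cases "i = v \<or> j = v")
      case True
      then show ?thesis using spoke[of i] spoke[of j] loop[of v] ij by (auto simp: insert_commute)
    next
      case False
      then show ?thesis using edge_iff[of i j] adj_AB[of i j] ij by auto
    qed
  next
    have "{u \<in> ?V. ?c u = 0} = {v}" using v by auto
    then show "card {u \<in> ?V. ?c u = 0} = 1" by simp
    have "{u \<in> ?V. ?c u = 1} = A" using AB(1) vAB by auto
    then show "card {u \<in> ?V. ?c u = 1} = m div 2" using AB(3) by simp
    have "{u \<in> ?V. ?c u = 2} = B" using AB(1,2) vAB by auto
    then show "card {u \<in> ?V. ?c u = 2} = m - m div 2" using AB(4) by simp
  qed (use fin in auto)
  then show ?thesis by (rule exI[of _ ?c])
qed

text \<open>The test vector gives each colour class the same total of cubes, which is forced by equality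
  in the arithmetic-geometric mean inequality.\<close>

lemma mu3_cubed_tripartite:
  assumes H: "coloured_graph H c (\<noteq>) 1 a b" and ab: "0 < a" "0 < b"
  shows "(real (a * b))\<^sup>2 \<le> mu3 H ^ 3"
proof -
  note D = coloured_graphD[OF H]
  let ?V = "vertex_set H"
  let ?A = "{u \<in> ?V. c u = 1}" and ?B = "{u \<in> ?V. c u = 2}"
  obtain v where v: "{u \<in> ?V. c u = 0} = {v}" using D(3) by (auto simp: card_1_singleton_iff)
  then have vV: "v \<in> ?V" "c v = 0" by auto
  \<comment> \<open>The centre has cube \<open>a * b\<close>, each vertex of the class of size \<open>a\<close> has cube \<open>b\<close>, and conversely.\<close>
  define \<alpha> \<beta> where "\<alpha> = root 3 (real a)" and "\<beta> = root 3 (real b)"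
  have \<alpha>: "0 < \<alpha>" "\<alpha> ^ 3 = real a" and \<beta>: "0 < \<beta>" "\<beta> ^ 3 = real b"
    using ab by (simp_all add: \<alpha>_def \<beta>_def)
  define x where "x u = (if c u = 0 then \<alpha> * \<beta> else if c u = 1 then \<beta> else \<alpha>)" for u
  have x: "0 < x u" for u using \<alpha>(1) \<beta>(1) by (simp add: x_def)
  have V: "?V = {u \<in> ?V. c u = 0} \<union> ?A \<union> ?B"
    by (rule coloured_graph_partition[OF H])
  have "(\<Sum>u\<in>?V. x u ^ 3) = (\<Sum>u\<in>{u \<in> ?V. c u = 0} \<union> ?A \<union> ?B. x u ^ 3)" using V by simp
  also have "\<dots> = (\<Sum>u\<in>{u \<in> ?V. c u = 0} \<union> ?A. x u ^ 3) + (\<Sum>u\<in>?B. x u ^ 3)"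
    using D(1) by (intro sum.union_disjoint) auto
  also have "(\<Sum>u\<in>{u \<in> ?V. c u = 0} \<union> ?A. x u ^ 3)
      = (\<Sum>u\<in>{u \<in> ?V. c u = 0}. x u ^ 3) + (\<Sum>u\<in>?A. x u ^ 3)"
    using D(1) by (intro sum.union_disjoint) auto
  also have "(\<Sum>u\<in>{u \<in> ?V. c u = 0}. x u ^ 3) = \<alpha> ^ 3 * \<beta> ^ 3"
    using v vV by (simp add: x_def power_mult_distrib)
  also have "(\<Sum>u\<in>?A. x u ^ 3) = \<alpha> ^ 3 * \<beta> ^ 3" using D(4) \<alpha>(2) by (simp add: x_def)
  also have "(\<Sum>u\<in>?B. x u ^ 3) = \<alpha> ^ 3 * \<beta> ^ 3" using D(5) \<beta>(2) by (simp add: x_def)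
  finally have norm: "(\<Sum>u\<in>?V. x u ^ 3) = 3 * (\<alpha> ^ 3 * \<beta> ^ 3)" by simp
  let ?t = "\<lambda>(i, j). {v, i, j}"
  have inj: "inj_on ?t (?A \<times> ?B)"
  proof (rule inj_onI, clarify)
    fix i j i' j' assume ij: "i \<in> ?V" "c i = 1" "j \<in> ?V" "c j = 2" "i' \<in> ?V" "c i' = 1" "j' \<in> ?V" "c j' = 2"
      and eq: "{v, i, j} = {v, i', j'}"
    have "i \<in> {v, i', j'}" "j \<in> {v, i', j'}" using eq by blast+
    then show "i = i' \<and> j = j'" using ij vV by auto
  qed
  have sub: "?t ` (?A \<times> ?B) \<subseteq> triangles H"
  proof clarify
    fix i j assume ij: "i \<in> ?V" "c i = 1" "j \<in> ?V" "c j = 2"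
    then have "v \<noteq> i" "v \<noteq> j" "i \<noteq> j" using vV by auto
    then show "{v, i, j} \<in> triangles H"
      using ij vV D(2) by (auto simp: triangles_iff_clique clique_def)
  qed
  have "real (a * b) * (\<alpha> * \<beta> * \<beta> * \<alpha>) = (\<Sum>p\<in>?A \<times> ?B. \<alpha> * \<beta> * \<beta> * \<alpha>)"
    using D(4,5) by (simp add: card_cartesian_product)
  also have "\<dots> = (\<Sum>p\<in>?A \<times> ?B. \<Prod>u\<in>?t p. x u)"
  proof (rule sum.cong[OF refl], clarify)
    fix i j assume ij: "i \<in> ?V" "c i = 1" "j \<in> ?V" "c j = 2"
    then have "v \<noteq> i" "v \<noteq> j" "i \<noteq> j" using vV by auto
    then show "\<alpha> * \<beta> * \<beta> * \<alpha> = (\<Prod>u\<in>{v, i, j}. x u)" using ij vV by (simp add: x_def)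
  qed
  also have "\<dots> = (\<Sum>T\<in>?t ` (?A \<times> ?B). \<Prod>u\<in>T. x u)" by (subst sum.reindex[OF inj]) simp
  also have "\<dots> \<le> triangle_sum H x"
    unfolding triangle_sum_def
    by (rule sum_mono2[OF finite_triangles[OF D(1)] sub]) (simp add: prod_nonneg less_imp_le[OF x])
  finally have low: "real (a * b) * (\<alpha> * \<beta> * \<beta> * \<alpha>) \<le> triangle_sum H x" .
  have "(\<alpha> * \<beta>)\<^sup>2 \<le> mu3 H"
  proof (rule mu3_ge[of H x])
    have "(\<alpha> * \<beta>)\<^sup>2 * (\<Sum>u\<in>?V. x u ^ 3) = 3 * (real (a * b) * (\<alpha> * \<beta> * \<beta> * \<alpha>))"
      unfolding norm using \<alpha>(2) \<beta>(2) by (simp add: power2_eq_square)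
    then show "(\<alpha> * \<beta>)\<^sup>2 * (\<Sum>u\<in>?V. x u ^ 3) \<le> 3 * triangle_sum H x" using low by simp
    show "\<exists>u\<in>?V. x u \<noteq> 0" using vV(1) x[of v] by force
  qed (use D(1) vV x in \<open>auto simp: less_imp_le\<close>)
  then have "((\<alpha> * \<beta>)\<^sup>2) ^ 3 \<le> mu3 H ^ 3" by (intro power_mono) auto
  moreover have "((\<alpha> * \<beta>)\<^sup>2) ^ 3 = (\<alpha> ^ 3 * \<beta> ^ 3)\<^sup>2"
    by (simp add: power_mult_distrib flip: power_mult)
  ultimately show ?thesis using \<alpha>(2) \<beta>(2) by simp
qed

lemma mu3_cubed_tripartite_eq:
  assumes H: "coloured_graph H c (\<noteq>) 1 (m div 2) (m - m div 2)" and m: "2 \<le> m"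
  shows "mu3 H ^ 3 = (real (m\<^sup>2 div 4))\<^sup>2"
proof (rule antisym)
  note D = coloured_graphD[OF H]
  let ?V = "vertex_set H"
  have prod: "m div 2 * (m - m div 2) = m\<^sup>2 div 4"
  proof (cases "even m")
    case True
    then obtain k where "m = 2 * k" by (rule evenE)
    then show ?thesis by (simp add: power2_eq_square)
  next
    case False
    then obtain k where "m = 2 * k + 1" by (rule oddE)
    moreover have "(2 * k + 1)\<^sup>2 = 1 + (k * (k + 1)) * 4" by (simp add: power2_eq_square algebra_simps)
    ultimately show ?thesis by simp
  qed
  show "(real (m\<^sup>2 div 4))\<^sup>2 \<le> mu3 H ^ 3"
    using mu3_cubed_tripartite[OF H] m unfolding prod by simp
  obtain v where v: "{u \<in> ?V. c u = 0} = {v}" using D(3) by (auto simp: card_1_singleton_iff)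
  interpret triangle_star H v
  proof
    show "finite ?V" by (rule D(1))
    show "v \<in> ?V" using v by auto
    fix T assume T: "T \<in> triangles H"
    obtain i j k where ijk: "T = {i, j, k}" "i \<noteq> j" "i \<noteq> k" "j \<noteq> k"
      using triangle_card[OF T] unfolding card_3_iff by blast
    have V: "i \<in> ?V" "j \<in> ?V" "k \<in> ?V" using triangle_subset[OF T] ijk(1) by auto
    have "{i, j} \<in> edge_set H" "{i, k} \<in> edge_set H" "{j, k} \<in> edge_set H"
      using triangle_edge[OF T] ijk by auto
    then have "c i \<noteq> c j" "c i \<noteq> c k" "c j \<noteq> c k" using D(2) V by auto
    then have "c i = 0 \<or> c j = 0 \<or> c k = 0" using D(6)[OF V(1)] D(6)[OF V(2)] D(6)[OF V(3)] by linarith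
    then show "v \<in> T" using v V ijk(1) by auto
  qed
  have "card ?V = m + 1" using coloured_graph_card[OF H] by simp
  then have "card (triangles H) \<le> m\<^sup>2 div 4" using card_triangles_le fin v by simp
  then have "(real (card (triangles H)))\<^sup>2 \<le> (real (m\<^sup>2 div 4))\<^sup>2" by (intro power_mono) auto
  with mu3_cubed_le_star show "mu3 H ^ 3 \<le> (real (m\<^sup>2 div 4))\<^sup>2" by (rule order_trans)
qed

section \<open>The extremal graphs\<close>

lemma doubleton_in_image_iff:
  assumes "inj f"
  shows "{f a, f b} \<in> (`) f ` E \<longleftrightarrow> {a, b} \<in> E"
proof -
  have "inj ((`) f)" using assms by (intro injI) (simp add: inj_image_eq_iff)
  from inj_image_mem_iff[OF this, of "{a, b}" E] show ?thesis by simp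
qed

lemma doubleton_image_Inl_Inr [simp]:
  "{Inl a, Inl b} \<in> (`) Inl ` E \<longleftrightarrow> {a, b} \<in> E" "{Inr c, Inr d} \<in> (`) Inr ` E' \<longleftrightarrow> {c, d} \<in> E'"
  "{Inl a, Inl b} \<notin> (`) Inr ` E'" "{Inr c, Inr d} \<notin> (`) Inl ` E"
  "{Inl a, Inr c} \<notin> (`) Inl ` E" "{Inl a, Inr c} \<notin> (`) Inr ` E'"
  "{Inr c, Inl a} \<notin> (`) Inl ` E" "{Inr c, Inl a} \<notin> (`) Inr ` E'"
  by (rule doubleton_in_image_iff[OF inj_Inl] doubleton_in_image_iff[OF inj_Inr] | blast)+

lemma edge_disjoint_union [simp]:
  "{Inl a, Inl b} \<in> edge_set (disjoint_union G H) \<longleftrightarrow> {a, b} \<in> edge_set G"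
  "{Inr c, Inr d} \<in> edge_set (disjoint_union G H) \<longleftrightarrow> {c, d} \<in> edge_set H"
  "{Inl a, Inr c} \<notin> edge_set (disjoint_union G H)"
  "{Inr c, Inl a} \<notin> edge_set (disjoint_union G H)"
  by (simp_all add: disjoint_union_def)

lemma edge_graph_join [simp]:
  "{Inl a, Inl b} \<in> edge_set (graph_join G H) \<longleftrightarrow> {a, b} \<in> edge_set G"
  "{Inr c, Inr d} \<in> edge_set (graph_join G H) \<longleftrightarrow> {c, d} \<in> edge_set H"
  "{Inl a, Inr c} \<in> edge_set (graph_join G H) \<longleftrightarrow> a \<in> vertex_set G \<and> c \<in> vertex_set H"
  "{Inr c, Inl a} \<in> edge_set (graph_join G H) \<longleftrightarrow> a \<in> vertex_set G \<and> c \<in> vertex_set H"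
  by (auto simp: graph_join_def doubleton_eq_iff)

lemmas loop_disjoint_union [simp] =
  edge_disjoint_union(1)[of a a for a, simplified] edge_disjoint_union(2)[of c c for c, simplified]

lemmas loop_graph_join [simp] =
  edge_graph_join(1)[of a a for a, simplified] edge_graph_join(2)[of c c for c, simplified]

lemma edge_complete_graph [simp]:
  "{a, b} \<in> edge_set (complete_graph n) \<longleftrightarrow> a < n \<and> b < n \<and> a \<noteq> b"
  by (auto simp: complete_graph_def card_insert_if)

lemma loop_complete_graph [simp]: "{a} \<notin> edge_set (complete_graph n)"
  by (auto simp: complete_graph_def)

lemma vertex_set_simps [simp]:
  "vertex_set (complete_graph n) = {..<n}"
  "vertex_set (disjoint_union G H) = vertex_set G <+> vertex_set H"
  "vertex_set (graph_join G H) = vertex_set G <+> vertex_set H"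
  "vertex_set (copies m F) = {..<m} \<times> vertex_set F"
  "vertex_set (turan2 m) = {..<m div 2} <+> {..<m - m div 2}"
  by (simp_all add: complete_graph_def disjoint_union_def graph_join_def copies_def turan2_def
      complete_bipartite_def)

lemma edge_turan2 [simp]:
  "{Inl i, Inr j} \<in> edge_set (turan2 m) \<longleftrightarrow> i < m div 2 \<and> j < m - m div 2"
  "{Inr j, Inl i} \<in> edge_set (turan2 m) \<longleftrightarrow> i < m div 2 \<and> j < m - m div 2"
  "{Inl i, Inl i'} \<notin> edge_set (turan2 m)"
  "{Inr j, Inr j'} \<notin> edge_set (turan2 m)"
  by (auto simp: turan2_def complete_bipartite_def doubleton_eq_iff)

lemma loop_turan2 [simp]: "{x} \<notin> edge_set (turan2 m)"
  by (auto simp: turan2_def complete_bipartite_def)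

lemma edge_copies_K1 [simp]: "edge_set (copies p (complete_graph (Suc 0))) = {}"
proof -
  have "edge_set (complete_graph (Suc 0)) = {}"
  proof -
    have "card e \<noteq> 2" if "e \<subseteq> {..<Suc 0}" for e
      using card_mono[OF _ that] by simp
    then show ?thesis by (auto simp: complete_graph_def)
  qed
  then show ?thesis by (simp add: copies_def)
qed

lemma Plus_class_sizes:
  "{w \<in> A <+> B. case_sum f g w = k} = {a \<in> A. f a = k} <+> {b \<in> B. g b = k}"
  by (auto simp: Plus_def)

lemma coloured_complete_graph:
  "coloured_graph (complete_graph n) (\<lambda>_. 0) (\<lambda>_ _. True) n 0 0"
  by (rule coloured_graphI) auto

lemma coloured_core_join:
  "coloured_graph (graph_join (complete_graph 3) (copies p (complete_graph 1)))
     (case_sum (\<lambda>_. 0) (\<lambda>_. 1)) core_adj 3 p 0"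
  by (rule coloured_graphI) (auto simp: Plus_class_sizes card_Plus card_cartesian_product)

lemma coloured_turan_join:
  "coloured_graph (graph_join (complete_graph 1) (turan2 m))
     (case_sum (\<lambda>_. 0) (case_sum (\<lambda>_. 1) (\<lambda>_. 2))) (\<noteq>) 1 (m div 2) (m - m div 2)"
  by (rule coloured_graphI) (auto simp: Plus_class_sizes card_Plus)

lemma coloured_K5_K1:
  "coloured_graph (disjoint_union (complete_graph 5) (complete_graph 1))
     (case_sum (\<lambda>_. 0) (\<lambda>_. 1)) (=) 5 1 0"
  by (rule coloured_graphI) (auto simp: Plus_class_sizes card_Plus)

lemma edge_pendant_K5:
  "e \<in> edge_set pendant_K5 \<longleftrightarrow>
    e = {Inl 0, Inr 0} \<or> e \<in> edge_set (disjoint_union (complete_graph 5) (complete_graph 1))"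
  by (simp add: pendant_K5_def add_edge_def)

lemma vertex_set_pendant_K5 [simp]: "vertex_set pendant_K5 = {..<5} <+> {..<1}"
  by (simp add: pendant_K5_def add_edge_def)

text \<open>Colour 2 is the pendant vertex, colour 1 its neighbour in the clique.\<close>

lemma coloured_pendant_K5:
  "coloured_graph pendant_K5 (case_sum (\<lambda>i. if i = 0 then 1 else 0) (\<lambda>_. 2))
     (\<lambda>i j. {i, j} \<noteq> {0, 2}) 4 1 1"
proof (rule coloured_graphI)
  have "{i \<in> {..<5::nat}. (if i = 0 then 1 else 0 :: nat) = 0} = {1..<5}" by auto
  then show "card {w \<in> vertex_set pendant_K5. case_sum (\<lambda>i. if i = 0 then 1 else 0) (\<lambda>_. 2) w = (0 :: nat)} = 4"
    unfolding vertex_set_pendant_K5 Plus_class_sizes by (simp add: card_Plus)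
  have "{i \<in> {..<5::nat}. (if i = 0 then 1 else 0 :: nat) = 1} = {0}" by auto
  then show "card {w \<in> vertex_set pendant_K5. case_sum (\<lambda>i. if i = 0 then 1 else 0) (\<lambda>_. 2) w = (1 :: nat)} = 1"
    unfolding vertex_set_pendant_K5 Plus_class_sizes by (simp add: card_Plus)
  have "{i \<in> {..<5::nat}. (if i = 0 then 1 else 0 :: nat) = 2} = {}" by auto
  then show "card {w \<in> vertex_set pendant_K5. case_sum (\<lambda>i. if i = 0 then 1 else 0) (\<lambda>_. 2) w = (2 :: nat)} = 1"
    unfolding vertex_set_pendant_K5 Plus_class_sizes by (simp add: card_Plus)
qed (auto simp: edge_pendant_K5 doubleton_eq_iff split: if_splits)

lemma mu3_ge_clique5:
  assumes fin: "finite (vertex_set G)" and Q: "clique G Q" "card Q = 5"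
  shows "6 \<le> mu3 G"
proof -
  have fQ: "finite Q" "Q \<subseteq> vertex_set G" using Q fin by (auto simp: clique_def finite_subset)
  obtain f where f: "bij_betw f {..<5 :: nat} Q"
    using ex_bij_betw_nat_finite[OF fQ(1)] Q(2) by (auto simp: atLeast0LessThan)
  then have inj: "inj_on f {..<5}" and im: "f ` {..<5} = Q" by (auto simp: bij_betw_def)
  have "mu3 (complete_graph 5) \<le> mu3 G"
  proof (rule mu3_mono_embedding[where f = f])
    fix T assume T: "T \<in> triangles (complete_graph 5)"
    show "f ` T \<in> triangles G"
    proof (rule triangle_image_graph_embedding[OF T])
      fix u v assume "{u, v} \<in> edge_set (complete_graph 5)" "u \<in> vertex_set (complete_graph 5)"
        "v \<in> vertex_set (complete_graph 5)"
      then have "f u \<in> Q" "f v \<in> Q" "f u \<noteq> f v" using inj im by (auto simp: inj_on_def)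
      then show "{f u, f v} \<in> edge_set G" using Q(1) by (simp add: clique_def)
    qed (use inj im fQ(2) in auto)
  qed (use inj im fQ(2) fin in \<open>auto simp: lessThan_empty_iff\<close>)
  moreover have "(4 :: nat) choose 2 = 6" by (simp add: numeral_eq_Suc)
  ultimately show ?thesis using mu3_complete[of 5] by simp
qed

lemma mu3_le_clique5:
  assumes "finite (vertex_set G)" "Q \<subseteq> vertex_set G" "card Q = 5"
    and "\<And>T. T \<in> triangles G \<Longrightarrow> T \<subseteq> Q"
  shows "mu3 G \<le> 6"
proof -
  have ne: "vertex_set G \<noteq> {}" using assms(2,3) by auto
  have c: "(card Q - 1) choose 2 = 6" using assms(3) by (simp add: numeral_eq_Suc)
  interpret perron_certificate G "{T. T \<subseteq> Q \<and> card T = 3}" "\<lambda>_. 1" "real ((card Q - 1) choose 2)"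
    by (rule perron_certificate_clique) (use assms ne in auto)
  show ?thesis using mu3_le_certificate c by simp
qed

lemma triangles_within_K5:
  assumes V: "vertex_set G = insert w Q"
    and few: "\<And>x y. x \<in> Q \<Longrightarrow> y \<in> Q \<Longrightarrow> {w, x} \<in> edge_set G \<Longrightarrow> {w, y} \<in> edge_set G \<Longrightarrow> x = y"
    and T: "T \<in> triangles G"
  shows "T \<subseteq> Q"
proof -
  have "w \<notin> T"
  proof
    assume "w \<in> T"
    then obtain x y where xy: "T = {w, x, y}" "w \<noteq> x" "w \<noteq> y" "x \<noteq> y"
      using card_3_iff_member[OF triangle_card[OF T]] by blast
    then have "x \<in> Q" "y \<in> Q" using triangle_subset[OF T] V by auto
    moreover have "{w, x} \<in> edge_set G" "{w, y} \<in> edge_set G" using triangle_edge[OF T] xy by auto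
    ultimately show False using few xy(4) by blast
  qed
  then show ?thesis using triangle_subset[OF T] V by auto
qed

lemma mu3_K5_K1: "mu3 (disjoint_union (complete_graph 5) (complete_graph 1)) = 6"
proof (rule antisym)
  let ?G = "disjoint_union (complete_graph 5) (complete_graph 1)" and ?Q = "Inl ` {..<5 :: nat} :: (nat + nat) set"
  have Q: "?Q \<subseteq> vertex_set ?G" "card ?Q = 5" by (auto simp: card_image)
  have V: "vertex_set ?G = insert (Inr 0) ?Q" by auto
  show "mu3 ?G \<le> 6"
  proof (rule mu3_le_clique5[OF _ Q triangles_within_K5[OF V]])
    show "finite (vertex_set ?G)" by simp
  qed auto
  show "6 \<le> mu3 ?G" by (rule mu3_ge_clique5[OF _ _ Q(2)]) (auto simp: clique_def)
qed

lemma mu3_pendant_K5: "mu3 pendant_K5 = 6"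
proof (rule antisym)
  let ?Q = "Inl ` {..<5 :: nat} :: (nat + nat) set"
  have Q: "?Q \<subseteq> vertex_set pendant_K5" "card ?Q = 5" by (auto simp: card_image)
  have V: "vertex_set pendant_K5 = insert (Inr 0) ?Q" by auto
  show "mu3 pendant_K5 \<le> 6"
  proof (rule mu3_le_clique5[OF _ Q triangles_within_K5[OF V]])
    show "finite (vertex_set pendant_K5)" by simp
  qed (auto simp: edge_pendant_K5 doubleton_eq_iff)
  show "6 \<le> mu3 pendant_K5"
    by (rule mu3_ge_clique5[OF _ _ Q(2)]) (auto simp: clique_def edge_pendant_K5)
qed

text \<open>Two neighbours of the sixth vertex \<open>w\<close> in \<open>Q\<close> would span a triangle with it that is not contained in \<open>Q\<close>.\<close>

lemma six_vertices_with_K5: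
  assumes simple: "simple_graph G" and V: "card (vertex_set G) = 6"
    and Q: "clique G Q" "card Q = 5" and tri: "\<And>T. T \<in> triangles G \<Longrightarrow> T \<subseteq> Q"
  shows "graph_iso G (disjoint_union (complete_graph 5) (complete_graph 1)) \<or> graph_iso G pendant_K5"
proof -
  have fin: "finite (vertex_set G)" using simple by (simp add: simple_graph_def)
  have QV: "Q \<subseteq> vertex_set G" "finite Q" using Q fin by (auto simp: clique_def finite_subset)
  have "card (vertex_set G - Q) = 1" using QV Q(2) V by (simp add: card_Diff_subset)
  then obtain w where "vertex_set G - Q = {w}" by (auto simp: card_1_singleton_iff)
  then have w: "vertex_set G = insert w Q" "w \<notin> Q" using QV(1) by auto
  have loop: "{u} \<notin> edge_set G" for u using simple by (auto simp: simple_graph_def)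
  have one: "x = y" if "x \<in> Q" "y \<in> Q" "{w, x} \<in> edge_set G" "{w, y} \<in> edge_set G" for x y
  proof (rule ccontr)
    assume "x \<noteq> y"
    then have "{w, x, y} \<in> triangles G"
      using that Q(1) w
      by (auto simp: triangles_iff_clique clique_def insert_commute card_insert_if)
    with tri w(2) show False by blast
  qed
  have inQ: "{u, v} \<in> edge_set G \<longleftrightarrow> u \<noteq> v" if "u \<in> Q" "v \<in> Q" for u v
    using Q(1) that loop[of u] by (auto simp: clique_def)
  show ?thesis
  proof (cases "\<exists>x\<in>Q. {w, x} \<in> edge_set G")
    case False
    let ?c = "\<lambda>u. if u = w then 1 else 0 :: nat"
    have "coloured_graph G ?c (=) 5 1 0"
    proof (rule coloured_graphI)
      have "{v \<in> vertex_set G. ?c v = 0} = Q" "{v \<in> vertex_set G. ?c v = 1} = {w}"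
        "{v \<in> vertex_set G. ?c v = 2} = {}" using w by auto
      then show "card {v \<in> vertex_set G. ?c v = 0} = 5" "card {v \<in> vertex_set G. ?c v = 1} = 1"
        "card {v \<in> vertex_set G. ?c v = 2} = 0" using Q(2) by simp_all
      fix u v assume "u \<in> vertex_set G" "v \<in> vertex_set G"
      then show "{u, v} \<in> edge_set G \<longleftrightarrow> u \<noteq> v \<and> ?c u = ?c v"
        using inQ[of u v] False loop[of w] w by (auto simp: insert_commute)
    qed (use fin in auto)
    then show ?thesis using coloured_graph_unique[OF _ coloured_K5_K1] by blast
  next
    case True
    then obtain x where x: "x \<in> Q" "{w, x} \<in> edge_set G" by blast
    have wy: "{w, y} \<in> edge_set G \<longleftrightarrow> y = x" if "y \<in> Q" for y using one x that by blast
    let ?c = "\<lambda>u. if u = w then 2 else if u = x then 1 else 0 :: nat"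
    have "coloured_graph G ?c (\<lambda>i j. {i, j} \<noteq> {0, 2}) 4 1 1"
    proof (rule coloured_graphI)
      have "{v \<in> vertex_set G. ?c v = 0} = Q - {x}" "{v \<in> vertex_set G. ?c v = 1} = {x}"
        "{v \<in> vertex_set G. ?c v = 2} = {w}" using w x by auto
      then show "card {v \<in> vertex_set G. ?c v = 0} = 4" "card {v \<in> vertex_set G. ?c v = 1} = 1"
        "card {v \<in> vertex_set G. ?c v = 2} = 1" using Q(2) x(1) by (simp_all add: card_Diff_singleton)
      fix u v assume uv: "u \<in> vertex_set G" "v \<in> vertex_set G"
      show "{u, v} \<in> edge_set G \<longleftrightarrow> u \<noteq> v \<and> {?c u, ?c v} \<noteq> {0, 2}"
      proof (cases "u = w \<or> v = w")
        case True
        then show ?thesis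
          using wy[of u] wy[of v] loop[of w] uv w by (auto simp: insert_commute doubleton_eq_iff)
      next
        case False
        then show ?thesis using inQ[of u v] uv w by (auto simp: doubleton_eq_iff)
      qed
    qed (use fin in auto)
    then show ?thesis using coloured_graph_unique[OF _ coloured_pendant_K5] by blast
  qed
qed

section \<open>Comparison of the cases\<close>

lemma intersecting_if_free:
  assumes "finite (vertex_set G)" "graph_free (copies 2 (complete_graph 3)) G"
  shows "intersecting_triangles G"
  using assms two_disjoint_triangles_copy by unfold_locales (auto simp: graph_free_def)

text \<open>The spectral consequence of each structural case, with \<open>p = n - 3\<close>.\<close>

lemma mu3_cases:
  assumes simple: "simple_graph G" and V: "card (vertex_set G) = p + 3" "0 < p"
    and free: "graph_free (copies 2 (complete_graph 3)) G"
    and par: "0 < \<theta>" "l = 1 + 2 * real p * \<theta>" "l * \<theta>\<^sup>2 = 3"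
  obtains
    (star) t where "mu3 G ^ 3 \<le> (real t)\<^sup>2" "t \<le> (p + 2)\<^sup>2 div 4"
      "t = (p + 2)\<^sup>2 div 4 \<Longrightarrow>
        \<exists>c. coloured_graph G c (\<noteq>) 1 ((p + 2) div 2) (p + 2 - (p + 2) div 2)"
  | (core) "mu3 G \<le> l" "mu3 G = l \<Longrightarrow> \<exists>c. coloured_graph G c core_adj 3 p 0"
  | (K5) Q where "clique G Q" "card Q = 5" "\<And>T. T \<in> triangles G \<Longrightarrow> T \<subseteq> Q" "mu3 G \<le> 6"
  | (few) "mu3 G ^ 3 \<le> 9 / 2 * (real (p + 3))\<^sup>2"
proof -
  have fin: "finite (vertex_set G)" using simple by (simp add: simple_graph_def)
  have ne: "vertex_set G \<noteq> {}" using V by auto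
  interpret intersecting_triangles G by (rule intersecting_if_free[OF fin free])
  from ne show ?thesis
  proof (cases rule: triangle_structure)
    case (star v)
    then interpret triangle_star G v using fin by unfold_locales auto
    have "card (vertex_set G - {v}) = p + 2" using V v fin by simp
    then show ?thesis
      using that(1)[of "card (triangles G)"] mu3_cubed_le_star card_triangles_le
        coloured_if_extremal[OF simple, of "p + 2"] V by simp
  next
    case (core A)
    have A: "A \<subseteq> vertex_set G" "card A = 3" using core(1) triangle_subset triangle_card by blast+
    show ?thesis using that(2) mu3_le_core[OF simple fin V A core(2) par] by blast
  next
    case (K5 Q)
    have "mu3 G \<le> 6"
      by (rule mu3_le_clique5[OF fin _ K5(2,3)]) (use K5(1) in \<open>simp add: clique_def\<close>)
    with K5 that(3) show ?thesis by blast
  next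
    case few
    have "mu3 G ^ 3 \<le> 9 / 2 * (real (card (triangles G)))\<^sup>2"
      by (rule mu3_cubed_le_card_triangles[OF fin ne])
    also have "\<dots> \<le> 9 / 2 * (real (p + 3))\<^sup>2"
      using few V by (intro mult_left_mono power_mono) auto
    finally show ?thesis by (rule that(4))
  qed
qed

context
  fixes \<theta> l :: real and p :: nat
  assumes par: "0 < \<theta>" "l = 1 + 2 * real p * \<theta>" "l * \<theta>\<^sup>2 = 3"
begin

lemma core_radius_ge_1: "1 \<le> l"
  using par by simp

lemma core_radius_gt:
  assumes "12 * (real p)\<^sup>2 > x * (x - 1)\<^sup>2"
  shows "x < l"
  using cubic_mono[OF core_radius_ge_1, of x] core_cubic_equation[OF par] assms by (rule_tac ccontr) simp

lemma core_radius_lt: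
  assumes "12 * (real p)\<^sup>2 < x * (x - 1)\<^sup>2" "1 \<le> x"
  shows "l < x"
  using cubic_mono[OF assms(2), of l] core_cubic_equation[OF par] assms(1) by (rule_tac ccontr) simp

end

text \<open>A rational \<open>x\<close> that separates the bounds for the star case and the few-triangles case from
  the core eigenvalue; see \<open>core_cubic_equation\<close>.\<close>

lemma core_beats_others:
  assumes "4 \<le> p" "p \<le> 10"
  shows "\<exists>x::real. 0 \<le> x \<and> x * (x - 1)\<^sup>2 < 12 * (real p)\<^sup>2 \<and>
    (real ((p + 2)\<^sup>2 div 4))\<^sup>2 \<le> x ^ 3 \<and> 9 / 2 * (real (p + 3))\<^sup>2 \<le> x ^ 3"
proof -
  have "p \<in> {4, 5, 6, 7, 8, 9, 10}" using assms by auto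
  then consider "p = 4" | "p = 5" | "p = 6" | "p = 7" | "p = 8" | "p = 9" | "p = 10" by auto
  then show ?thesis
  proof cases
    case 1 show ?thesis unfolding 1
      by (rule exI[of _ "605 / 100"]) (simp add: power2_eq_square power3_eq_cube)
  next
    case 2 show ?thesis unfolding 2
      by (rule exI[of _ "67 / 10"]) (simp add: power2_eq_square power3_eq_cube)
  next
    case 3 show ?thesis unfolding 3
      by (rule exI[of _ "72 / 10"]) (simp add: power2_eq_square power3_eq_cube)
  next
    case 4 show ?thesis unfolding 4
      by (rule exI[of _ "77 / 10"]) (simp add: power2_eq_square power3_eq_cube)
  next
    case 5 show ?thesis unfolding 5
      by (rule exI[of _ "86 / 10"]) (simp add: power2_eq_square power3_eq_cube)
  next
    case 6 show ?thesis unfolding 6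
      by (rule exI[of _ "97 / 10"]) (simp add: power2_eq_square power3_eq_cube)
  next
    case 7 show ?thesis unfolding 7
      by (rule exI[of _ "1095 / 100"]) (simp add: power2_eq_square power3_eq_cube)
  qed
qed

text \<open>Here \<open>B\<close> is the spectral radius of \<open>K\<^sub>1 \<or> T\<^sub>2(p + 2)\<close>, and the first inequality places
  the core eigenvalue below it. The margin is small at \<open>p = 11\<close>,
  where the core eigenvalue is exactly 12 and \<open>B ^ 3 = 42\<^sup>2 = 1764\<close>, just above \<open>12 ^ 3 = 1728\<close>.\<close>

lemma tripartite_beats_others:
  fixes B :: real and p :: nat
  assumes p: "11 \<le> p" and B: "0 \<le> B" "B ^ 3 = (real ((p + 2)\<^sup>2 div 4))\<^sup>2"
  shows "12 * (real p)\<^sup>2 < B * (B - 1)\<^sup>2" "12 < B" "9 / 2 * (real (p + 3))\<^sup>2 < B ^ 3"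
proof -
  define N where "N = (p + 2)\<^sup>2 div 4"
  have "(p + 2)\<^sup>2 mod 4 < 2"
  proof (cases "even p")
    case True
    then obtain k where "p = 2 * k" by (rule evenE)
    then have "(p + 2)\<^sup>2 = 4 * (k + 1)\<^sup>2" by (simp add: power2_eq_square algebra_simps)
    then show ?thesis by simp
  next
    case False
    then obtain k where "p = 2 * k + 1" by (rule oddE)
    then have "(p + 2)\<^sup>2 = 1 + 4 * (k\<^sup>2 + 3 * k + 2)" by (simp add: power2_eq_square algebra_simps)
    then have "(p + 2)\<^sup>2 mod 4 = 1" by (simp only: mod_mult_self2) simp
    then show ?thesis by simp
  qed
  then have "(p + 2)\<^sup>2 \<le> 4 * N + 1"
    unfolding N_def using mult_div_mod_eq[of 4 "(p + 2)\<^sup>2"] by linarith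
  then have "real ((p + 2)\<^sup>2) \<le> real (4 * N + 1)" by (rule of_nat_mono)
  then have N: "(real p + 2)\<^sup>2 \<le> 4 * real N + 1" by (simp add: add.commute)
  have p': "11 \<le> real p" using p by simp
  \<comment> \<open>The product is \<open>11 * ((p + 2)\<^sup>2 - 1) - 168 * p\<close>, so the bound on \<open>N\<close> is tight at \<open>p = 11\<close>.\<close>
  have "0 \<le> (real p - 11) * (11 * real p - 3)" using p' by (intro mult_nonneg_nonneg) auto
  then have N1: "42 * real p \<le> 11 * real N" using N by (simp add: power2_eq_square algebra_simps)
  have "0 \<le> (real p - 11) * (real p + 3)" using p' by (intro mult_nonneg_nonneg) auto
  then have N2: "3 * (real p + 3) \<le> real N" using N by (simp add: power2_eq_square algebra_simps)
  have B3: "B ^ 3 = (real N)\<^sup>2" using B(2) by (simp add: N_def)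
  show "12 < B"
  proof -
    have "(12 :: real) ^ 3 < 42\<^sup>2" by simp
    also have "\<dots> \<le> (real N)\<^sup>2" using N1 p' by (intro power_mono) auto
    finally have "12 ^ 3 < B ^ 3" using B3 by simp
    then show ?thesis using B(1) by (rule power_less_imp_less_base)
  qed
  \<comment> \<open>Since \<open>B\<close> exceeds 12, passing from \<open>B - 1\<close> to \<open>11 / 12 * B\<close> leaves a multiple of \<open>B ^ 3\<close>, which is known.\<close>
  then have B12: "11 / 12 * B \<le> B - 1" by simp
  have "12 * (real p)\<^sup>2 < (42 / 12 * real p)\<^sup>2" using p' by (simp add: power_mult_distrib power_divide)
  also have "\<dots> \<le> (11 / 12 * real N)\<^sup>2" using N1 p' by (intro power_mono) auto
  also have "\<dots> = B * (11 / 12 * B)\<^sup>2"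
    using B3 by (simp add: power_mult_distrib power_divide power2_eq_square power3_eq_cube)
  also have "\<dots> \<le> B * (B - 1)\<^sup>2" using B12 B(1) by (intro mult_left_mono power_mono) auto
  finally show "12 * (real p)\<^sup>2 < B * (B - 1)\<^sup>2" .
  have "9 / 2 * (real (p + 3))\<^sup>2 < (3 * (real p + 3))\<^sup>2"
  proof -
    have "(3 * (real p + 3))\<^sup>2 = 9 * (real (p + 3))\<^sup>2" unfolding power_mult_distrib by simp
    moreover have "0 < (real (p + 3))\<^sup>2" by simp
    ultimately show ?thesis by linarith
  qed
  also have "\<dots> \<le> (real N)\<^sup>2" using N2 by (intro power_mono) auto
  finally show "9 / 2 * (real (p + 3))\<^sup>2 < B ^ 3" using B3 by simp
qed

lemma extremal_small:
  fixes G :: "'a sgraph"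
  assumes simple: "simple_graph G" and n: "card (vertex_set G) = n" "3 \<le> n"
  shows "mu3 G \<le> mu3 (complete_graph n) \<and>
    (mu3 G = mu3 (complete_graph n) \<longleftrightarrow> graph_iso G (complete_graph n))"
proof -
  have fin: "finite (vertex_set G)" using simple by (simp add: simple_graph_def)
  have ne: "vertex_set G \<noteq> {}" using n by auto
  have K: "mu3 (complete_graph n) = real ((n - 1) choose 2)" using n by (intro mu3_complete) simp
  have "graph_iso G (complete_graph n)" if eq: "mu3 G = mu3 (complete_graph n)"
  proof (rule coloured_graph_unique[OF _ coloured_complete_graph])
    have loop: "{u} \<notin> edge_set G" for u using simple by (auto simp: simple_graph_def)
    have adj: "{u, v} \<in> edge_set G" if "u \<in> vertex_set G" "v \<in> vertex_set G" "u \<noteq> v" for u v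
      using mu3_le_complete(2)[OF fin n] eq K that by simp
    show "coloured_graph G (\<lambda>_. 0) (\<lambda>_ _. True) n 0 0"
    proof (rule coloured_graphI)
      fix u v assume "u \<in> vertex_set G" "v \<in> vertex_set G"
      then show "{u, v} \<in> edge_set G \<longleftrightarrow> u \<noteq> v \<and> True" using adj[of u v] loop[of u] by auto
    qed (use fin n in auto)
  qed
  then show ?thesis using mu3_le_complete(1)[OF fin n] K mu3_graph_iso[OF _ fin ne] by metis
qed

lemma extremal_six:
  fixes G :: "'a sgraph"
  assumes simple: "simple_graph G" and n: "card (vertex_set G) = 6"
    and free: "graph_free (copies 2 (complete_graph 3)) G"
  shows "mu3 G \<le> mu3 (disjoint_union (complete_graph 5) (complete_graph 1)) \<and>
    (mu3 G = mu3 (disjoint_union (complete_graph 5) (complete_graph 1)) \<longleftrightarrow>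
      graph_iso G (disjoint_union (complete_graph 5) (complete_graph 1)) \<or> graph_iso G pendant_K5)"
proof -
  have fin: "finite (vertex_set G)" using simple by (simp add: simple_graph_def)
  have ne: "vertex_set G \<noteq> {}" using n by auto
  obtain \<theta> l :: real where par: "0 < \<theta>" "l = 1 + 2 * real 3 * \<theta>" "l * \<theta>\<^sup>2 = 3"
    by (rule core_parameters[of 3])
  have l6: "l < 6" by (rule core_radius_lt[OF par]) simp_all
  have n3: "card (vertex_set G) = 3 + 3" using n by simp
  have "mu3 G < 6 \<or> mu3 G \<le> 6 \<and> (graph_iso G (disjoint_union (complete_graph 5) (complete_graph 1)) \<or>
      graph_iso G pendant_K5)"
    using simple n3 zero_less_numeral free par
  proof (cases rule: mu3_cases)
    case (star t)
    have "mu3 G ^ 3 \<le> (real t)\<^sup>2" by (rule star(1))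
    also have "\<dots> \<le> 6\<^sup>2" using star(2) by (intro power_mono) auto
    also have "\<dots> < 6 ^ 3" by simp
    finally have "mu3 G < 6" by (rule power_less_imp_less_base) simp
    then show ?thesis by simp
  next
    case core
    then show ?thesis using l6 by simp
  next
    case (K5 Q)
    then show ?thesis using six_vertices_with_K5[OF simple n K5(1,2)] by blast
  next
    case few
    then have "mu3 G ^ 3 < 6 ^ 3" by simp
    then have "mu3 G < 6" by (rule power_less_imp_less_base) simp
    then show ?thesis by simp
  qed
  moreover have "mu3 G = 6" if "graph_iso G (disjoint_union (complete_graph 5) (complete_graph 1)) \<or>
      graph_iso G pendant_K5"
    using that mu3_graph_iso[OF _ fin ne] mu3_K5_K1 mu3_pendant_K5 by metis
  ultimately show ?thesis unfolding mu3_K5_K1 by linarith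
qed

lemma extremal_middle:
  fixes G :: "'a sgraph"
  assumes simple: "simple_graph G" and n: "card (vertex_set G) = p + 3" "4 \<le> p" "p \<le> 10"
    and free: "graph_free (copies 2 (complete_graph 3)) G"
  shows "mu3 G \<le> mu3 (graph_join (complete_graph 3) (copies p (complete_graph 1))) \<and>
    (mu3 G = mu3 (graph_join (complete_graph 3) (copies p (complete_graph 1))) \<longleftrightarrow>
      graph_iso G (graph_join (complete_graph 3) (copies p (complete_graph 1))))"
    (is "_ \<le> mu3 ?H \<and> _")
proof -
  have fin: "finite (vertex_set G)" using simple by (simp add: simple_graph_def)
  have ne: "vertex_set G \<noteq> {}" and p: "0 < p" using n by auto
  obtain \<theta> l :: real where par: "0 < \<theta>" "l = 1 + 2 * real p * \<theta>" "l * \<theta>\<^sup>2 = 3"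
    by (rule core_parameters[of p])
  have H: "mu3 ?H = l" by (rule mu3_core_graph[OF coloured_core_join par])
  obtain x :: real where x: "0 \<le> x" "x * (x - 1)\<^sup>2 < 12 * (real p)\<^sup>2"
    "(real ((p + 2)\<^sup>2 div 4))\<^sup>2 \<le> x ^ 3" "9 / 2 * (real (p + 3))\<^sup>2 \<le> x ^ 3"
    using core_beats_others[OF n(2,3)] by blast
  have xl: "x < l" by (rule core_radius_gt[OF par x(2)])
  have small: "mu3 G < l" if "mu3 G ^ 3 \<le> x ^ 3"
  proof -
    have "mu3 G \<le> x"
    proof (rule ccontr)
      assume "\<not> ?thesis"
      then have "x ^ 3 < mu3 G ^ 3" using x(1) by (intro power_strict_mono) auto
      with that show False by simp
    qed
    with xl show ?thesis by simp
  qed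
  have "mu3 G < l \<or> mu3 G \<le> l \<and> (mu3 G = l \<longrightarrow> graph_iso G ?H)"
    using simple n(1) p free par
  proof (cases rule: mu3_cases)
    case (star t)
    have "mu3 G ^ 3 \<le> (real t)\<^sup>2" by (rule star(1))
    also have "\<dots> \<le> (real ((p + 2)\<^sup>2 div 4))\<^sup>2" using star(2) by (intro power_mono) auto
    also have "\<dots> \<le> x ^ 3" by (rule x(3))
    finally show ?thesis using small by simp
  next
    case core
    then show ?thesis using coloured_graph_unique[OF _ coloured_core_join] by blast
  next
    case (K5 Q)
    have "4\<^sup>2 \<le> (real p)\<^sup>2" using n(2) by (intro power_mono) auto
    then have "6 < l" by (intro core_radius_gt[OF par]) simp
    then show ?thesis using K5(4) by simp
  next
    case few
    then show ?thesis using small x(4) by simp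
  qed
  then show ?thesis using H mu3_graph_iso[OF _ fin ne, of ?H] by auto
qed

lemma extremal_large:
  fixes G :: "'a sgraph"
  assumes simple: "simple_graph G" and n: "card (vertex_set G) = p + 3" "11 \<le> p"
    and free: "graph_free (copies 2 (complete_graph 3)) G"
  shows "mu3 G \<le> mu3 (graph_join (complete_graph 1) (turan2 (p + 2))) \<and>
    (mu3 G = mu3 (graph_join (complete_graph 1) (turan2 (p + 2))) \<longleftrightarrow>
      graph_iso G (graph_join (complete_graph 1) (turan2 (p + 2))))"
    (is "_ \<le> mu3 ?H \<and> _")
proof -
  have fin: "finite (vertex_set G)" using simple by (simp add: simple_graph_def)
  have ne: "vertex_set G \<noteq> {}" and p: "0 < p" using n by auto
  obtain \<theta> l :: real where par: "0 < \<theta>" "l = 1 + 2 * real p * \<theta>" "l * \<theta>\<^sup>2 = 3"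
    by (rule core_parameters[of p])
  have H3: "mu3 ?H ^ 3 = (real ((p + 2)\<^sup>2 div 4))\<^sup>2"
    by (rule mu3_cubed_tripartite_eq[OF coloured_turan_join]) simp
  have H0: "0 \<le> mu3 ?H" by (rule mu3_nonneg) auto
  note beats = tripartite_beats_others[OF n(2) H0 H3]
  have lH: "l < mu3 ?H" using beats(1,2) by (intro core_radius_lt[OF par]) auto
  have "mu3 G < mu3 ?H \<or> mu3 G \<le> mu3 ?H \<and> (mu3 G = mu3 ?H \<longrightarrow> graph_iso G ?H)"
    using simple n(1) p free par
  proof (cases rule: mu3_cases)
    case (star t)
    have le: "mu3 G ^ 3 \<le> (real t)\<^sup>2" by (rule star(1))
    show ?thesis
    proof (cases "t = (p + 2)\<^sup>2 div 4")
      case True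
      then have "mu3 G ^ 3 \<le> mu3 ?H ^ 3" using le H3 by simp
      then have "mu3 G \<le> mu3 ?H" using H0 by (meson not_le power_strict_mono zero_less_numeral)
      then show ?thesis using star(3)[OF True] coloured_graph_unique[OF _ coloured_turan_join] by blast
    next
      case False
      then have "(real t)\<^sup>2 < (real ((p + 2)\<^sup>2 div 4))\<^sup>2"
        using star(2) by (intro power_strict_mono) auto
      then have "mu3 G ^ 3 < mu3 ?H ^ 3" using le H3 by simp
      then have "mu3 G < mu3 ?H" using H0 by (rule power_less_imp_less_base)
      then show ?thesis by simp
    qed
  next
    case core
    then show ?thesis using lH by simp
  next
    case (K5 Q)
    then show ?thesis using beats(2) by simp
  next
    case few
    then have "mu3 G ^ 3 < mu3 ?H ^ 3" using beats(3) by simp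
    then have "mu3 G < mu3 ?H" using H0 by (rule power_less_imp_less_base)
    then show ?thesis by simp
  qed
  then show ?thesis using mu3_graph_iso[OF _ fin ne, of ?H] by auto
qed

theorem theorem1p9:
  fixes n :: nat and G :: "'a sgraph"
  assumes "n \<ge> 3"
    and "simple_graph G"
    and "card (vertex_set G) = n"
    and "graph_free (copies 2 (complete_graph 3)) G"
  shows "(3 \<le> n \<and> n \<le> 5 \<longrightarrow>
            mu3 G \<le> mu3 (complete_graph n) \<and>
            (mu3 G = mu3 (complete_graph n) \<longleftrightarrow> graph_iso G (complete_graph n))) \<and>
         (n = 6 \<longrightarrow>
            mu3 G \<le> mu3 (disjoint_union (complete_graph 5) (complete_graph 1)) \<and>
            (mu3 G = mu3 (disjoint_union (complete_graph 5) (complete_graph 1)) \<longleftrightarrow>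
               graph_iso G (disjoint_union (complete_graph 5) (complete_graph 1)) \<or>
               graph_iso G pendant_K5)) \<and>
         (7 \<le> n \<and> n \<le> 13 \<longrightarrow>
            mu3 G \<le> mu3 (graph_join (complete_graph 3) (copies (n - 3) (complete_graph 1))) \<and>
            (mu3 G = mu3 (graph_join (complete_graph 3) (copies (n - 3) (complete_graph 1))) \<longleftrightarrow>
               graph_iso G (graph_join (complete_graph 3) (copies (n - 3) (complete_graph 1))))) \<and>
         (n \<ge> 14 \<longrightarrow>
            mu3 G \<le> mu3 (graph_join (complete_graph 1) (turan2 (n - 1))) \<and>
            (mu3 G = mu3 (graph_join (complete_graph 1) (turan2 (n - 1))) \<longleftrightarrow>
               graph_iso G (graph_join (complete_graph 1) (turan2 (n - 1)))))"
proof (intro conjI[OF impI] impI)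
  define p where "p = n - 3"
  have n: "card (vertex_set G) = p + 3" "n - 1 = p + 2" using assms(1,3) by (auto simp: p_def)
  show "mu3 G \<le> mu3 (complete_graph n) \<and>
      (mu3 G = mu3 (complete_graph n) \<longleftrightarrow> graph_iso G (complete_graph n))" if "3 \<le> n \<and> n \<le> 5"
    by (rule extremal_small[OF assms(2,3,1)])
  show "mu3 G \<le> mu3 (disjoint_union (complete_graph 5) (complete_graph 1)) \<and>
      (mu3 G = mu3 (disjoint_union (complete_graph 5) (complete_graph 1)) \<longleftrightarrow>
        graph_iso G (disjoint_union (complete_graph 5) (complete_graph 1)) \<or>
        graph_iso G pendant_K5)" if "n = 6"
    using extremal_six[OF assms(2) _ assms(4)] assms(3) that by simp
  show "mu3 G \<le> mu3 (graph_join (complete_graph 3) (copies (n - 3) (complete_graph 1))) \<and>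
      (mu3 G = mu3 (graph_join (complete_graph 3) (copies (n - 3) (complete_graph 1))) \<longleftrightarrow>
        graph_iso G (graph_join (complete_graph 3) (copies (n - 3) (complete_graph 1))))"
    if "7 \<le> n \<and> n \<le> 13"
    using extremal_middle[OF assms(2) n(1) _ _ assms(4)] that unfolding p_def by auto
  show "mu3 G \<le> mu3 (graph_join (complete_graph 1) (turan2 (n - 1))) \<and>
      (mu3 G = mu3 (graph_join (complete_graph 1) (turan2 (n - 1))) \<longleftrightarrow>
        graph_iso G (graph_join (complete_graph 1) (turan2 (n - 1))))" if "n \<ge> 14"
    unfolding n(2) by (rule extremal_large[OF assms(2) n(1) _ assms(4)]) (use that p_def in simp)
qed

end
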